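(* Let $\Sigma=[\sigma_{hk}]$ be a $p\times p$ Hermitian positive definite complex matrix and let $\alpha=(n_1,m_1,\dots,n_p,m_p)\in\mathbb Z_{\ge0}^{2p}$. Let $N=\{h:n_h\neq0\}$, $M=\{k:m_k\neq0\}$, $S^N_h=\{k\in M:\sigma_{hk}\neq0\}$ for $h\in N$, and let $\{M_1,\dots,M_q\}$ be the partition of $M$ induced by the sets $S^N_h$. Assume that for every $r=1,\dots,q$, $$\sum_{i\in N:\ S^N_i\subset M_r} n_i=\sum_{j\in M_r} m_j .$$ Then the $\alpha$-moment of $\mathcal{CN}_p(\Sigma)$ is $$\nu(\alpha)=\sum_{a\in I(\alpha)}\Pi(\alpha,a),\qquad \Pi(\alpha,a)=\prod_{h=1}^p n_h!\,m_h!\prod_{h,k=1}^p\frac{\sigma_{hk}^{a_{hk}}}{a_{hk}!},$$ where $\sigma_{hk}^0:=1$ also when $\sigma_{hk}=0$.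
   Context: The complex normal distribution $\mathcal{CN}_p(\Sigma)$ on $\mathbb C^p\cong\mathbb R^{2p}$ has density $\varphi(z;\Sigma)=\frac{1}{\pi^p\det\Sigma}\exp(-z^*\Sigma^{-1}z)$ with respect to Lebesgue measure $dz$ on $\mathbb R^{2p}$. For a multi-index $\alpha=(n_1,m_1,\dots,n_p,m_p)\in\mathbb Z_{\ge0}^{2p}$ the $\alpha$-moment is $\nu(\alpha)=\int_{\mathbb C^p}\prod_{j=1}^p z_j^{n_j}\bar z_j^{m_j}\varphi(z;\Sigma)\,dz$; in particular $\sigma_{hk}=\nu(e_{2h-1}+e_{2k})$ (the entries of $\Sigma$). Induced partition: form the graph with vertex set $M$ in which two vertices are joined iff both belong to the same $S^N_h$ for some $h\in N$; its connected components form the partition of $M$ induced by the $S^N_h$. The set $I(\alpha)$: it is the set of vectors $a=(a_{11},\dots,a_{1p},a_{21},\dots,a_{pp})\in\mathbb Z_{\ge0}^{p^2}$ such that $l_{ij}(\alpha,a)\le a_{ij}\le L_{ij}(\alpha,a)$ for all $i,j=1,\dots,p$, where $$l_{ij}(\alpha,a)=\max\Big(0,\ \sum_{h=1}^i n_h-\sum_{h=j+1}^p m_h-\sum_{\substack{h\le i,\,k\le j\\ (h,k)\neq(i,j)}}a_{hk}\Big),\qquad L_{ij}(\alpha,a)=\min\Big(n_i-\sum_{h=1}^{j-1}a_{ih},\ m_j-\sum_{h=1}^{i-1}a_{hj}\Big).$$ (The paper writes $\wedge$ for this max and $\vee$ for this min.) *)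

theory Defs
  imports "HOL-Probability.Probability" "Jordan_Normal_Form.Determinant"
begin

text \<open>Conventions: indices are 0-based, i.e. the paper's index h = 1..p corresponds to
  h = 0..p-1 here.  The multi-index alpha = (n_1,m_1,...,n_p,m_p) is given by the two
  functions n, m :: nat => nat (only values below p matter).  The covariance matrix
  Sigma is a p x p complex matrix (Jordan_Normal_Form).  A point z of C^p is a function
  nat => complex (coordinates 0..p-1), and C^p = R^(2p) carries the product of the
  Lebesgue measures lborel on complex = R^2.\<close>

definition hermitian_pd :: "nat \<Rightarrow> complex mat \<Rightarrow> bool" where
  "hermitian_pd p S \<longleftrightarrow> S \<in> carrier_mat p p
     \<and> (\<forall>i<p. \<forall>j<p. S $$ (i,j) = cnj (S $$ (j,i)))
     \<and> (\<forall>v \<in> carrier_vec p. v \<noteq> 0\<^sub>v p \<longrightarrow> Re (scalar_prod (conjugate v) (S *\<^sub>v v)) > 0)"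

definition inv_mat :: "nat \<Rightarrow> complex mat \<Rightarrow> complex mat" where
  "inv_mat p S = (THE B. B \<in> carrier_mat p p \<and> S * B = 1\<^sub>m p \<and> B * S = 1\<^sub>m p)"

definition cn_density :: "nat \<Rightarrow> complex mat \<Rightarrow> (nat \<Rightarrow> complex) \<Rightarrow> complex" where
  "cn_density p S z =
     (let zv = Matrix.vec p z in
      exp (- scalar_prod (conjugate zv) (inv_mat p S *\<^sub>v zv)) / (complex_of_real pi ^ p * Determinant.det S))"

definition lebesgue_Cp :: "nat \<Rightarrow> (nat \<Rightarrow> complex) measure" where
  "lebesgue_Cp p = PiM {..<p} (\<lambda>_. (lborel :: complex measure))"

definition cn_moment :: "nat \<Rightarrow> complex mat \<Rightarrow> (nat \<Rightarrow> nat) \<Rightarrow> (nat \<Rightarrow> nat) \<Rightarrow> complex" where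
  "cn_moment p S n m =
     (LINT z | lebesgue_Cp p. (\<Prod>j<p. z j ^ n j * cnj (z j) ^ m j) * cn_density p S z)"

definition induced_partition :: "nat set \<Rightarrow> nat set \<Rightarrow> (nat \<Rightarrow> nat set) \<Rightarrow> nat set set" where
  "induced_partition V H T =
     (let E = {(j,k). j \<in> V \<and> k \<in> V \<and> (\<exists>h\<in>H. j \<in> T h \<and> k \<in> T h)}
      in {{y \<in> V. (x,y) \<in> E\<^sup>*} | x. x \<in> V})"

definition l_bound :: "nat \<Rightarrow> (nat \<Rightarrow> nat) \<Rightarrow> (nat \<Rightarrow> nat) \<Rightarrow> (nat \<Rightarrow> nat \<Rightarrow> nat) \<Rightarrow> nat \<Rightarrow> nat \<Rightarrow> int" where
  "l_bound p n m a i j = max 0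
     ((\<Sum>h\<in>{..i}. int (n h)) - (\<Sum>h\<in>{j<..<p}. int (m h))
      - (\<Sum>(h,k)\<in>({..i} \<times> {..j}) - {(i,j)}. int (a h k)))"

definition L_bound :: "(nat \<Rightarrow> nat) \<Rightarrow> (nat \<Rightarrow> nat) \<Rightarrow> (nat \<Rightarrow> nat \<Rightarrow> nat) \<Rightarrow> nat \<Rightarrow> nat \<Rightarrow> int" where
  "L_bound n m a i j = min
     (int (n i) - (\<Sum>h<j. int (a i h)))
     (int (m j) - (\<Sum>h<i. int (a h j)))"

definition I_set :: "nat \<Rightarrow> (nat \<Rightarrow> nat) \<Rightarrow> (nat \<Rightarrow> nat) \<Rightarrow> (nat \<Rightarrow> nat \<Rightarrow> nat) set" where
  "I_set p n m = {a. (\<forall>i j. (p \<le> i \<or> p \<le> j) \<longrightarrow> a i j = 0)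
       \<and> (\<forall>i<p. \<forall>j<p. l_bound p n m a i j \<le> int (a i j) \<and> int (a i j) \<le> L_bound n m a i j)}"

text \<open>Pi(alpha, a); note that 0 ^ 0 = 1 in Isabelle, matching the convention sigma^0 = 1.\<close>
definition Pi_term :: "nat \<Rightarrow> complex mat \<Rightarrow> (nat \<Rightarrow> nat) \<Rightarrow> (nat \<Rightarrow> nat) \<Rightarrow> (nat \<Rightarrow> nat \<Rightarrow> nat) \<Rightarrow> complex" where
  "Pi_term p S n m a =
     (\<Prod>h<p. of_nat (fact (n h) * fact (m h)))
     * (\<Prod>h<p. \<Prod>k<p. S $$ (h,k) ^ a h k / of_nat (fact (a h k)))"

end

theory Submission
  imports Defs
begin

text \<open>
  The Gaussian moments satisfy the Wick recursion
  \<open>\<nu>(n + e\<^sub>h, m) = (\<Sum>k. \<sigma>\<^sub>h\<^sub>k m\<^sub>k \<nu>(n, m - e\<^sub>k))\<close>, obtained by integrating by parts in one complex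
  coordinate at a time (Stein's identity). The sum of \<open>\<Pi>(\<alpha>, a)\<close> over all tables \<open>a\<close> with row sums \<open>n\<close>
  and column sums \<open>m\<close> satisfies the same recursion, so it equals \<open>\<nu>(\<alpha>)\<close> without any balance
  assumption. If \<open>n\<close> and \<open>m\<close> have equal totals, \<open>I(\<alpha>)\<close> is exactly the set of these tables. If the
  totals differ, there are no such tables, so \<open>\<nu>(\<alpha>) = 0\<close>; the balance assumption then forces some
  \<open>h\<close> with \<open>n\<^sub>h \<noteq> 0\<close> and \<open>S\<^sup>N\<^sub>h = {}\<close>, and since elements of \<open>I(\<alpha>)\<close> always have row sums \<open>n\<close> and
  column sums at most \<open>m\<close>, every \<open>\<Pi>(\<alpha>, a)\<close> contains a factor \<open>0\<close>.
\<close>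

subsection \<open>Gaussian integrals on the complex plane\<close>

lemma measurable_Complex_pair [measurable]:
  "(\<lambda>(x, y). Complex x y) \<in> borel_measurable (lborel \<Otimes>\<^sub>M lborel)"
  unfolding Complex_eq by measurable

text \<open>Lebesgue measure is determined by its values on boxes, and a box in the plane is a
  product of intervals for the real and imaginary parts. This opens planar integrals to
  Fubini.\<close>

lemma lborel_complex_eq_distr:
  "lborel = distr (lborel \<Otimes>\<^sub>M lborel) borel (\<lambda>(x, y). Complex x y)"
proof (rule lborel_eqI)
  fix l u :: complex
  assume le: "\<And>b. b \<in> Basis \<Longrightarrow> l \<bullet> b \<le> u \<bullet> b"
  have le': "Re l \<le> Re u" "Im l \<le> Im u"
    using le[of 1] le[of \<i>] by (auto simp: Basis_complex_def)
  have "(\<lambda>(x, y). Complex x y) -` box l u \<inter> space (lborel \<Otimes>\<^sub>M lborel)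
      = {Re l<..<Re u} \<times> {Im l<..<Im u}"
    by (auto simp: in_box_complex_iff space_pair_measure)
  then have "emeasure (distr (lborel \<Otimes>\<^sub>M lborel) borel (\<lambda>(x, y). Complex x y)) (box l u)
      = emeasure (lborel \<Otimes>\<^sub>M lborel) ({Re l<..<Re u} \<times> {Im l<..<Im u})"
    by (subst emeasure_distr) auto
  also have "\<dots> = ennreal ((Re u - Re l) * (Im u - Im l))"
    using le' by (subst lborel.emeasure_pair_measure_Times) (auto simp: ennreal_mult)
  also have "(Re u - Re l) * (Im u - Im l) = (\<Prod>b\<in>Basis. (u - l) \<bullet> b)"
    by (simp add: Basis_complex_def)
  finally show "emeasure (distr (lborel \<Otimes>\<^sub>M lborel) borel (\<lambda>(x, y). Complex x y)) (box l u)
      = ennreal (\<Prod>b\<in>Basis. (u - l) \<bullet> b)" .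
qed simp

lemma integrable_lborel_complex_iff:
  fixes f :: "complex \<Rightarrow> 'a::{banach, second_countable_topology}"
  assumes [measurable]: "f \<in> borel_measurable borel"
  shows "integrable lborel f \<longleftrightarrow> integrable (lborel \<Otimes>\<^sub>M lborel) (\<lambda>(x, y). f (Complex x y))"
  using integrable_distr_eq[OF measurable_Complex_pair, of f]
  unfolding lborel_complex_eq_distr[symmetric] by (simp add: split_beta')

lemma integral_lborel_complex:
  fixes f :: "complex \<Rightarrow> 'a::{banach, second_countable_topology}"
  assumes [measurable]: "f \<in> borel_measurable borel"
  shows "(LINT z|lborel. f z) = integral\<^sup>L (lborel \<Otimes>\<^sub>M lborel) (\<lambda>(x, y). f (Complex x y))"
  using integral_distr[OF measurable_Complex_pair, of f]
  unfolding lborel_complex_eq_distr[symmetric] by (simp add: split_beta')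

text \<open>The integrand is a multiple of the centred normal density with variance
  \<open>1 / (2 * b)\<close>, whose total mass is 1.\<close>

lemma gaussian_real:
  fixes b :: real
  assumes "0 < b"
  shows "has_bochner_integral lborel (\<lambda>x. exp (- b * x\<^sup>2)) (sqrt (pi / b))"
proof -
  define s where "s = 1 / sqrt (2 * b)"
  have s: "0 < s" "2 * s\<^sup>2 = 1 / b"
    using assms by (auto simp: s_def power_divide)
  have eq: "exp (- b * x\<^sup>2) = sqrt (pi / b) * normal_density 0 s x" for x
  proof -
    have "- (x - 0)\<^sup>2 / (2 * s\<^sup>2) = - b * x\<^sup>2" using s(2) by simp
    moreover have "2 * pi * s\<^sup>2 = pi / b" using s(2) by (simp add: mult.assoc mult.left_commute)
    ultimately show ?thesis using assms by (simp add: normal_density_def)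
  qed
  have "has_bochner_integral lborel (normal_density 0 s) 1"
    using s by (simp add: has_bochner_integral_iff)
  from has_bochner_integral_mult_right[OF this, of "sqrt (pi / b)"] show ?thesis
    unfolding eq by simp
qed

lemma gaussian_complex:
  fixes b :: real
  assumes "0 < b"
  shows "has_bochner_integral lborel (\<lambda>z::complex. exp (- b * (norm z)\<^sup>2)) (pi / b)"
proof -
  note g = gaussian_real[OF assms]
  have eq: "exp (- b * (norm (Complex x y))\<^sup>2) = exp (- b * x\<^sup>2) * exp (- b * y\<^sup>2)" for x y
    by (simp add: cmod_power2 exp_add[symmetric] algebra_simps)
  have int: "integrable (lborel \<Otimes>\<^sub>M lborel) (\<lambda>(x, y). exp (- b * x\<^sup>2) * exp (- b * y\<^sup>2))"
    using g by (intro lborel_pair.Fubini_integrable) (auto simp: has_bochner_integral_iff abs_mult)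
  have "integral\<^sup>L (lborel \<Otimes>\<^sub>M lborel) (\<lambda>(x, y). exp (- b * x\<^sup>2) * exp (- b * y\<^sup>2)) = pi / b"
    using assms has_bochner_integral_integral_eq[OF g]
    by (subst lborel_pair.integral_fst[OF int, symmetric]) (simp add: real_sqrt_mult_self)
  with int show ?thesis
    unfolding eq[symmetric]
    by (simp add: has_bochner_integral_iff integrable_lborel_complex_iff integral_lborel_complex)
qed

section \<open>Gaussian decay and integration by parts in the plane\<close>

text \<open>Fundamental theorem of calculus on the whole line: the second bound makes
  \<open>f'\<close> integrable, and the first makes the boundary values of \<open>f\<close> at both
  infinities vanish.\<close>

lemma integral_deriv_eq_0_of_gaussian_decay:
  fixes f f' :: "real \<Rightarrow> complex" and C \<beta> :: real
  assumes "0 < \<beta>"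
    and deriv: "\<And>x. (f has_vector_derivative f' x) (at x)"
    and cont: "\<And>x. isCont f' x"
    and bound: "\<And>x. norm (f x) \<le> C * exp (- \<beta> * x\<^sup>2)"
    and bound': "\<And>x. norm (f' x) \<le> C * exp (- \<beta> * x\<^sup>2)"
  shows "(LINT x|lborel. f' x) = 0"
proof -
  have meas: "f' \<in> borel_measurable lborel"
    using cont by (simp add: borel_measurable_continuous_onI continuous_at_imp_continuous_on)
  have "integrable lborel (\<lambda>x. C * exp (- \<beta> * x\<^sup>2))"
    using gaussian_real[OF \<open>0 < \<beta>\<close>] by (auto simp: has_bochner_integral_iff)
  then have int: "integrable lborel f'"
    by (rule Bochner_Integration.integrable_bound)
       (use meas bound' in \<open>auto intro!: order_trans[OF bound'] AE_I2\<close>)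
  have lim: "((\<lambda>x. C * exp (- \<beta> * x\<^sup>2)) \<longlongrightarrow> 0) F" if "F = at_top \<or> F = at_bot" for F
  proof -
    have "filterlim (\<lambda>x::real. x\<^sup>2) at_top F"
      using that by (auto intro: filterlim_pow_at_top filterlim_ident filterlim_pow_at_bot_even)
    then have "filterlim (\<lambda>x. - (\<beta> * x\<^sup>2)) at_bot F"
      using \<open>0 < \<beta>\<close> by (simp add: filterlim_uminus_at_bot filterlim_tendsto_pos_mult_at_top[OF tendsto_const])
    then have "((\<lambda>x. exp (- (\<beta> * x\<^sup>2))) \<longlongrightarrow> 0) F"
      by (rule filterlim_compose[OF exp_at_bot])
    from tendsto_mult_right_zero[OF this, of C] show ?thesis by simp
  qed
  have flim: "(f \<longlongrightarrow> 0) F" if "F = at_top \<or> F = at_bot" for F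
    by (rule Lim_null_comparison[OF _ lim[OF that]]) (use bound in auto)
  have "(LBINT x=-\<infinity>..\<infinity>. f' x) = 0 - 0"
    by (rule interval_integral_FTC_integrable[where F = f])
       (use deriv cont int flim in \<open>auto simp: ereal_tendsto_simps1 set_integrable_def\<close>)
  then show ?thesis
    by (simp add: interval_integral_to_infinity_eq interval_lebesgue_integral_def set_lebesgue_integral_def)
qed

lemma power_le_fact_mult_exp:
  fixes r :: real
  assumes "0 \<le> r"
  shows "r ^ N \<le> fact N * exp r"
proof -
  have "(\<Sum>n\<in>{N}. r ^ n /\<^sub>R fact n) \<le> (\<Sum>n. r ^ n /\<^sub>R fact n)"
    by (rule sum_le_suminf) (use assms summable_exp_generic[of r] in auto)
  then show ?thesis
    by (simp add: exp_def field_simps)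
qed

text \<open>The power is absorbed into \<open>exp r\<close> up to a factorial; completing the square
  then lets half of the quadratic term pay for the whole linear term.\<close>

lemma power_mult_exp_le_gaussian:
  fixes b K r :: real
  assumes "0 < b" "0 \<le> r"
  shows "r ^ N * exp (K * r - b * r\<^sup>2) \<le> fact N * exp ((K + 1)\<^sup>2 / (2 * b)) * exp (- (b / 2) * r\<^sup>2)"
proof -
  have "0 \<le> (K + 1 - b * r)\<^sup>2 / (2 * b)" using assms by simp
  also have "\<dots> = (K + 1)\<^sup>2 / (2 * b) - (K + 1) * r + b / 2 * r\<^sup>2"
    using assms by (simp add: power2_eq_square field_simps)
  finally have le: "r + (K * r - b * r\<^sup>2) \<le> (K + 1)\<^sup>2 / (2 * b) + - (b / 2) * r\<^sup>2"
    by (simp add: algebra_simps)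
  have "r ^ N * exp (K * r - b * r\<^sup>2) \<le> fact N * exp r * exp (K * r - b * r\<^sup>2)"
    using power_le_fact_mult_exp[OF assms(2)] by (intro mult_right_mono) auto
  also have "\<dots> = fact N * exp (r + (K * r - b * r\<^sup>2))"
    by (simp only: exp_add mult.assoc)
  also have "\<dots> \<le> fact N * exp ((K + 1)\<^sup>2 / (2 * b) + - (b / 2) * r\<^sup>2)"
    using le by simp
  finally show ?thesis by (simp only: exp_add mult.assoc)
qed

definition gauss_monomial :: "real \<Rightarrow> complex \<Rightarrow> nat \<Rightarrow> nat \<Rightarrow> complex \<Rightarrow> complex" where
  "gauss_monomial b c n m z =
     z ^ n * cnj z ^ m * exp (- (of_real b * (z * cnj z) + c * cnj z + cnj c * z))"

lemma continuous_gauss_monomial [continuous_intros]: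
  "continuous_on UNIV f \<Longrightarrow> continuous_on UNIV (\<lambda>x. gauss_monomial b c n m (f x))"
  unfolding gauss_monomial_def by (intro continuous_intros)

lemma measurable_gauss_monomial [measurable]: "gauss_monomial b c n m \<in> borel_measurable borel"
  using continuous_gauss_monomial[OF continuous_on_id] by (rule borel_measurable_continuous_onI)

lemma gauss_monomial_bound:
  assumes "0 < b"
  shows "norm (gauss_monomial b c n m z)
    \<le> fact (n + m) * exp ((2 * norm c + 1)\<^sup>2 / (2 * b)) * exp (- (b / 2) * (norm z)\<^sup>2)"
proof -
  have "Re (- (of_real b * (z * cnj z) + c * cnj z + cnj c * z)) = - b * (norm z)\<^sup>2 - 2 * Re (c * cnj z)"
    by (simp add: cmod_power2) (simp add: algebra_simps power2_eq_square)
  also have "\<dots> \<le> 2 * norm c * norm z - b * (norm z)\<^sup>2"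
    using abs_Re_le_cmod[of "c * cnj z"] by (simp add: norm_mult)
  finally have "norm (gauss_monomial b c n m z)
      \<le> norm z ^ (n + m) * exp (2 * norm c * norm z - b * (norm z)\<^sup>2)"
    unfolding gauss_monomial_def
    by (simp add: norm_mult norm_power power_add mult_left_mono)
  also have "\<dots> \<le> fact (n + m) * exp ((2 * norm c + 1)\<^sup>2 / (2 * b)) * exp (- (b / 2) * (norm z)\<^sup>2)"
    using assms by (intro power_mult_exp_le_gaussian) auto
  finally show ?thesis .
qed

lemma integrable_gauss_monomial:
  assumes "0 < b"
  shows "integrable lborel (gauss_monomial b c n m)"
proof (rule Bochner_Integration.integrable_bound)
  show "integrable lborel (\<lambda>z::complex. fact (n + m) * exp ((2 * norm c + 1)\<^sup>2 / (2 * b))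
      * exp (- (b / 2) * (norm z)\<^sup>2))"
    using gaussian_complex[of "b / 2"] assms by (auto simp: has_bochner_integral_iff)
qed (use gauss_monomial_bound[OF assms] in \<open>auto intro!: AE_I2 order_trans[OF gauss_monomial_bound[OF assms]]\<close>)

text \<open>The Wirtinger derivative of \<open>gauss_monomial\<close> in \<open>z\<close>;
  \<open>gauss_dzbar\<close> is the one in the conjugate variable. At exponent 0 the truncated
  \<open>n - 1\<close> is harmless, because the factor \<open>of_nat n\<close> vanishes.\<close>

definition gauss_dz :: "real \<Rightarrow> complex \<Rightarrow> nat \<Rightarrow> nat \<Rightarrow> complex \<Rightarrow> complex" where
  "gauss_dz b c n m z = of_nat n * gauss_monomial b c (n - 1) m z
     - of_real b * gauss_monomial b c n (Suc m) z - cnj c * gauss_monomial b c n m z"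

definition gauss_dzbar :: "real \<Rightarrow> complex \<Rightarrow> nat \<Rightarrow> nat \<Rightarrow> complex \<Rightarrow> complex" where
  "gauss_dzbar b c n m z = of_nat m * gauss_monomial b c n (m - 1) z
     - of_real b * gauss_monomial b c (Suc n) m z - c * gauss_monomial b c n m z"

text \<open>Chain rule with \<open>z\<close> and its conjugate treated as two separate variables;
  along a line of direction \<open>u\<close> they move with velocities \<open>u\<close> and
  \<open>cnj u\<close>.\<close>

lemma has_vector_derivative_gauss_monomial:
  "((\<lambda>t. gauss_monomial b c n m (w + of_real t * u)) has_vector_derivative
     (u * gauss_dz b c n m (w + of_real t * u) + cnj u * gauss_dzbar b c n m (w + of_real t * u))) (at t)"
proof -
  define z where "z = (\<lambda>t::real. w + of_real t * u)"
  \<comment> \<open>The conjugate of \<open>z t\<close> is named as a curve of its own: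
    \<open>cnj\<close> has no complex derivative, but powers and the exponential can be composed
    with both curves.\<close>
  define v where "v = (\<lambda>t::real. cnj w + of_real t * cnj u)"
  have dz: "(z has_vector_derivative u) (at t)"
    unfolding z_def by (auto intro!: derivative_eq_intros simp: has_vector_derivative_def scaleR_conv_of_real)
  have dv: "(v has_vector_derivative cnj u) (at t)"
    unfolding v_def by (auto intro!: derivative_eq_intros simp: has_vector_derivative_def scaleR_conv_of_real)
  have cpow: "((\<lambda>x. x ^ k) has_field_derivative of_nat k * x ^ (k - 1)) (at x)" for k and x :: complex
    by (auto intro!: derivative_eq_intros)
  have pz: "((\<lambda>t. z t ^ n) has_vector_derivative u * (of_nat n * z t ^ (n - 1))) (at t)"
    using field_vector_diff_chain_at[OF dz cpow[of n "z t"]] by (simp add: o_def)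
  have pv: "((\<lambda>t. v t ^ m) has_vector_derivative cnj u * (of_nat m * v t ^ (m - 1))) (at t)"
    using field_vector_diff_chain_at[OF dv cpow[of m "v t"]] by (simp add: o_def)
  have dE: "((\<lambda>t. - (of_real b * (z t * v t) + c * v t + cnj c * z t)) has_vector_derivative
       - (of_real b * (z t * cnj u + u * v t) + c * cnj u + cnj c * u)) (at t)"
    by (intro has_vector_derivative_minus has_vector_derivative_add has_vector_derivative_mult_right
        has_vector_derivative_mult dz dv)
  have dexp: "((\<lambda>t. exp (- (of_real b * (z t * v t) + c * v t + cnj c * z t))) has_vector_derivative
       (- (of_real b * (z t * cnj u + u * v t) + c * cnj u + cnj c * u))
         * exp (- (of_real b * (z t * v t) + c * v t + cnj c * z t))) (at t)"
    using field_vector_diff_chain_at[OF dE DERIV_exp] by (simp add: o_def)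
  have d: "((\<lambda>t. gauss_monomial b c n m (z t)) has_vector_derivative
       z t ^ n * v t ^ m * ((- (of_real b * (z t * cnj u + u * v t) + c * cnj u + cnj c * u))
         * exp (- (of_real b * (z t * v t) + c * v t + cnj c * z t)))
       + (z t ^ n * (cnj u * (of_nat m * v t ^ (m - 1))) + u * (of_nat n * z t ^ (n - 1)) * v t ^ m)
         * exp (- (of_real b * (z t * v t) + c * v t + cnj c * z t))) (at t)"
    using has_vector_derivative_mult[OF has_vector_derivative_mult[OF pz pv] dexp]
    by (simp add: gauss_monomial_def z_def v_def)
  have cz: "cnj (z t) = v t" by (simp add: z_def v_def)
  have "((\<lambda>t. gauss_monomial b c n m (z t)) has_vector_derivative
      u * gauss_dz b c n m (z t) + cnj u * gauss_dzbar b c n m (z t)) (at t)"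
    by (rule has_vector_derivative_eq_rhs[OF d])
       (simp add: gauss_dz_def gauss_dzbar_def gauss_monomial_def cz algebra_simps)
  then show ?thesis by (simp only: z_def)
qed

text \<open>Each Wirtinger derivative is a combination of three Gaussian monomials. A single
  constant serves both estimates, as \<open>integral_deriv_eq_0_of_gaussian_decay\<close>
  requires.\<close>

lemma gauss_derivatives_bound:
  assumes "0 < b"
  obtains C where "\<And>z. norm (gauss_monomial b c n m z) \<le> C * exp (- (b / 2) * (norm z)\<^sup>2)"
    and "\<And>z. norm (gauss_dz b c n m z) + norm (gauss_dzbar b c n m z) \<le> C * exp (- (b / 2) * (norm z)\<^sup>2)"
proof -
  define K where "K = (\<lambda>i j. fact (i + j) * exp ((2 * norm c + 1)\<^sup>2 / (2 * b)))"
  define E where "E = (\<lambda>z::complex. exp (- (b / 2) * (norm z)\<^sup>2))"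
  have K: "norm (gauss_monomial b c i j z) \<le> K i j * E z" for i j z
    using gauss_monomial_bound[OF assms] unfolding K_def E_def .
  define D where "D = n * K (n - 1) m + b * K n (Suc m) + norm c * K n m"
  define D' where "D' = m * K n (m - 1) + b * K (Suc n) m + norm c * K n m"
  have pos: "0 \<le> K i j" "0 \<le> E z" for i j z by (auto simp: K_def E_def)
  have "norm (gauss_dz b c n m z) \<le> D * E z" for z
  proof -
    have "norm (gauss_dz b c n m z) \<le> norm (of_nat n * gauss_monomial b c (n - 1) m z)
      + norm (of_real b * gauss_monomial b c n (Suc m) z) + norm (cnj c * gauss_monomial b c n m z)"
      unfolding gauss_dz_def by (intro order_trans[OF norm_triangle_ineq4] add_mono order_refl)
    also have "\<dots> \<le> n * (K (n - 1) m * E z) + b * (K n (Suc m) * E z) + norm c * (K n m * E z)"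
      using assms by (simp only: norm_mult) (intro add_mono mult_mono K, auto)
    finally show ?thesis by (simp add: D_def algebra_simps)
  qed
  moreover have "norm (gauss_dzbar b c n m z) \<le> D' * E z" for z
  proof -
    have "norm (gauss_dzbar b c n m z) \<le> norm (of_nat m * gauss_monomial b c n (m - 1) z)
      + norm (of_real b * gauss_monomial b c (Suc n) m z) + norm (c * gauss_monomial b c n m z)"
      unfolding gauss_dzbar_def by (intro order_trans[OF norm_triangle_ineq4] add_mono order_refl)
    also have "\<dots> \<le> m * (K n (m - 1) * E z) + b * (K (Suc n) m * E z) + norm c * (K n m * E z)"
      using assms by (simp only: norm_mult) (intro add_mono mult_mono K, auto)
    finally show ?thesis by (simp add: D'_def algebra_simps)
  qed
  ultimately have 1: "norm (gauss_dz b c n m z) + norm (gauss_dzbar b c n m z) \<le> (K n m + D + D') * E z" for z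
    using pos(1)[of n m] pos(2)[of z]
    by (smt (verit) distrib_right mult_nonneg_nonneg)
  have "0 \<le> D" "0 \<le> D'" using assms pos by (auto simp: D_def D'_def)
  then have 2: "norm (gauss_monomial b c n m z) \<le> (K n m + D + D') * E z" for z
    using pos(2)[of z] by (intro order_trans[OF K] mult_right_mono) auto
  show thesis
    using that[OF 2[unfolded E_def] 1[unfolded E_def]] .
qed

text \<open>The condition on \<open>w\<close> turns decay in the modulus of the point into decay in
  the parameter \<open>t\<close>. It holds for lines parallel to a coordinate axis and parametrised
  from the other axis.\<close>

lemma integral_line_derivative_eq_0:
  assumes "0 < b" and w: "\<And>t. (norm (w + of_real t * u))\<^sup>2 \<ge> t\<^sup>2" and u: "norm u = 1"
  shows "(LINT t|lborel. u * gauss_dz b c n m (w + of_real t * u)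
      + cnj u * gauss_dzbar b c n m (w + of_real t * u)) = 0"
proof -
  obtain C where C: "\<And>z. norm (gauss_monomial b c n m z) \<le> C * exp (- (b / 2) * (norm z)\<^sup>2)"
    "\<And>z. norm (gauss_dz b c n m z) + norm (gauss_dzbar b c n m z) \<le> C * exp (- (b / 2) * (norm z)\<^sup>2)"
    using gauss_derivatives_bound[OF assms(1), of c n m] by blast
  have "0 \<le> C" using order_trans[OF norm_ge_zero C(1)[of 0]] by simp
  then have le: "C * exp (- (b / 2) * (norm (w + of_real t * u))\<^sup>2) \<le> C * exp (- (b / 2) * t\<^sup>2)" for t
    using w[of t] assms(1) by (intro mult_left_mono) auto
  have "continuous_on UNIV (\<lambda>t. u * gauss_dz b c n m (w + of_real t * u)
      + cnj u * gauss_dzbar b c n m (w + of_real t * u))"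
    unfolding gauss_dz_def gauss_dzbar_def by (intro continuous_intros)
  then have cont: "isCont (\<lambda>t. u * gauss_dz b c n m (w + of_real t * u)
      + cnj u * gauss_dzbar b c n m (w + of_real t * u)) t" for t
    by (simp add: continuous_on_eq_continuous_at)
  have "norm (u * gauss_dz b c n m z + cnj u * gauss_dzbar b c n m z) \<le> C * exp (- (b / 2) * (norm z)\<^sup>2)" for z
    by (rule order_trans[OF norm_triangle_ineq]) (use C(2) u in \<open>simp add: norm_mult\<close>)
  note bound' = order_trans[OF this le]
  show ?thesis
    by (rule integral_deriv_eq_0_of_gaussian_decay[OF _ has_vector_derivative_gauss_monomial cont
          order_trans[OF C(1) le] bound']) (use assms(1) in simp)
qed

lemma measurable_gauss_derivatives [measurable]:
  "gauss_dz b c n m \<in> borel_measurable borel" "gauss_dzbar b c n m \<in> borel_measurable borel"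
  unfolding gauss_dz_def[abs_def] gauss_dzbar_def[abs_def] by measurable

lemma integrable_gauss_derivatives:
  assumes "0 < b"
  shows "integrable lborel (gauss_dz b c n m)" "integrable lborel (gauss_dzbar b c n m)"
  unfolding gauss_dz_def[abs_def] gauss_dzbar_def[abs_def]
  using integrable_gauss_monomial[OF assms] by auto

text \<open>Both \<open>\<partial>\<^sub>x = \<partial> + \<partial>'\<close> and \<open>\<partial>\<^sub>y = \<i> (\<partial> - \<partial>')\<close> of a Gaussian monomial integrate to 0 along lines,
  hence so does the Wirtinger derivative \<open>\<partial>'\<close>.\<close>
lemma integral_gauss_dzbar:
  assumes "0 < b"
  shows "(LINT z|lborel. gauss_dzbar b c n m z) = 0"
proof -
  note int = integrable_gauss_derivatives[OF assms, of c n m]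
  define F where "F = (\<lambda>u z. u * gauss_dz b c n m z + cnj u * gauss_dzbar b c n m z)"
  have [measurable]: "F u \<in> borel_measurable borel" for u unfolding F_def by measurable
  have intF: "integrable lborel (F u)" for u
    using int by (auto simp: F_def)
  have intF2: "integrable (lborel \<Otimes>\<^sub>M lborel) (\<lambda>(x, y). F u (Complex x y))" for u
    using intF[of u] by (simp add: integrable_lborel_complex_iff)
  have "(LINT x|lborel. F 1 (Complex x y)) = 0" for y
    using integral_line_derivative_eq_0[OF assms, of "\<i> * of_real y" 1 c n m]
    by (simp add: F_def Complex_eq cmod_power2 add.commute)
  then have 1: "(LINT z|lborel. F 1 z) = 0"
    using lborel_pair.integral_snd[OF intF2[of 1]] by (simp add: integral_lborel_complex)
  have "(LINT y|lborel. F \<i> (Complex x y)) = 0" for x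
    using integral_line_derivative_eq_0[OF assms, of "of_real x" \<i> c n m]
    by (simp add: F_def Complex_eq cmod_power2 mult.commute)
  then have 2: "(LINT z|lborel. F \<i> z) = 0"
    using lborel_pair.integral_fst[OF intF2[of \<i>]] by (simp add: integral_lborel_complex)
  have "(LINT z|lborel. gauss_dz b c n m z) + (LINT z|lborel. gauss_dzbar b c n m z) = 0"
    using 1 int by (simp add: F_def)
  moreover have "\<i> * ((LINT z|lborel. gauss_dz b c n m z) - (LINT z|lborel. gauss_dzbar b c n m z)) = 0"
    using 2 int by (simp add: F_def algebra_simps)
  ultimately show ?thesis
    by (simp add: algebra_simps)
qed

subsection \<open>Positive definite forms\<close>

text \<open>Matrices and vectors are plain functions here, which matches the points of the product
  measure and makes changing one coordinate a function update.\<close>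

definition sesq :: "nat \<Rightarrow> (nat \<Rightarrow> nat \<Rightarrow> complex) \<Rightarrow> (nat \<Rightarrow> complex) \<Rightarrow> complex" where
  "sesq p A z = (\<Sum>i<p. \<Sum>j<p. cnj (z i) * A i j * z j)"

lemma sesq_unit:
  assumes "k < p"
  shows "sesq p A (\<lambda>i. of_bool (i = k)) = A k k"
proof -
  have "sesq p A (\<lambda>i. of_bool (i = k)) = (\<Sum>i<p. if i = k then \<Sum>j<p. if j = k then A k k else 0 else 0)"
    unfolding sesq_def by (intro sum.cong refl) (auto intro!: sum.cong)
  then show ?thesis using assms by simp
qed

text \<open>\<open>S\<close> is the covariance and \<open>B\<close> its inverse. With entry
  functions the dimension can drop in an induction while \<open>S\<close> stays the same;
  \<open>pos\<close> asks for a nonzero entry below \<open>p\<close> since later entries do not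
  enter the form.\<close>

locale hpd_inverse =
  fixes p :: nat and S B :: "nat \<Rightarrow> nat \<Rightarrow> complex"
  assumes herm: "\<And>i j. i < p \<Longrightarrow> j < p \<Longrightarrow> S i j = cnj (S j i)"
    and pos: "\<And>v i. i < p \<Longrightarrow> v i \<noteq> 0 \<Longrightarrow> 0 < Re (sesq p S v)"
    and SB: "\<And>i j. i < p \<Longrightarrow> j < p \<Longrightarrow> (\<Sum>k<p. S i k * B k j) = of_bool (i = j)"
    and BS: "\<And>i j. i < p \<Longrightarrow> j < p \<Longrightarrow> (\<Sum>k<p. B i k * S k j) = of_bool (i = j)"
begin

lemma sum_of_bool_mult:
  assumes "i < p"
  shows "(\<Sum>k<p. of_bool (k = i) * f k) = (f i :: complex)" "(\<Sum>k<p. of_bool (i = k) * f k) = f i"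
    "(\<Sum>k<p. f k * of_bool (k = i)) = f i" "(\<Sum>k<p. f k * of_bool (i = k)) = f i"
  using assms by (simp_all add: of_bool_def if_distrib if_distribR sum.delta sum.delta' cong: if_cong)

text \<open>In matrix terms, with \<open>*\<close> for the adjoint: B* = B* (S B) = (S B)* B = B,
  because S is its own adjoint.\<close>

lemma B_herm:
  assumes "i < p" "j < p"
  shows "B i j = cnj (B j i)"
proof -
  have "cnj (B j i) = (\<Sum>l<p. of_bool (l = j) * cnj (B l i))"
    using assms by (simp only: sum_of_bool_mult)
  also have "\<dots> = (\<Sum>l<p. (\<Sum>k<p. S l k * B k j) * cnj (B l i))"
    using assms by (intro sum.cong refl) (simp only: SB lessThan_iff)
  also have "\<dots> = (\<Sum>l<p. \<Sum>k<p. B k j * cnj (S k l * B l i))"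
    unfolding sum_distrib_right
    by (intro sum.cong refl) (simp, subst herm, auto)
  also have "\<dots> = (\<Sum>k<p. B k j * cnj (\<Sum>l<p. S k l * B l i))"
    by (subst sum.swap) (simp add: sum_distrib_left)
  also have "\<dots> = (\<Sum>k<p. B k j * of_bool (k = i))"
    using assms by (intro sum.cong refl) (simp add: SB del: cnj_sum)
  also have "\<dots> = B i j"
    using assms by (simp only: sum_of_bool_mult)
  finally show ?thesis by simp
qed

lemma sesq_B_real: "sesq p B z \<in> \<real>"
proof -
  have "cnj (sesq p B z) = (\<Sum>i<p. \<Sum>j<p. cnj (z j) * cnj (B i j) * z i)"
    by (simp add: sesq_def ac_simps)
  also have "\<dots> = (\<Sum>i<p. \<Sum>j<p. cnj (z j) * B j i * z i)"
    by (intro sum.cong refl) (subst (2) B_herm, auto)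
  also have "\<dots> = sesq p B z"
    unfolding sesq_def by (rule sum.swap)
  finally show ?thesis by (simp add: Reals_cnj_iff)
qed

lemma S_diag:
  assumes "k < p"
  shows "S k k \<in> \<real>" "0 < Re (S k k)"
proof -
  show "S k k \<in> \<real>" using herm[OF assms assms] by (simp add: Reals_cnj_iff)
  show "0 < Re (S k k)"
    using pos[OF assms, of "\<lambda>i. of_bool (i = k)"] by (simp add: sesq_unit[OF assms])
qed

text \<open>Cauchy--Schwarz for the form \<open>S\<close>, applied to \<open>e\<^sub>k\<close> and \<open>B z\<close>.\<close>
lemma norm_sq_le_sesq_B:
  assumes k: "k < p"
  shows "(norm (z k))\<^sup>2 \<le> Re (S k k) * Re (sesq p B z)"
proof -
  define v where "v i = (\<Sum>j<p. B i j * z j)" for i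
  define \<sigma> where "\<sigma> = Re (S k k)"
  have \<sigma>: "S k k = of_real \<sigma>" "0 < \<sigma>"
    using S_diag[OF k] by (auto simp: \<sigma>_def)
  \<comment> \<open>This is the coefficient of the projection of \<open>v\<close> onto the k-th unit
    vector in the inner product of \<open>S\<close>. The remainder \<open>w\<close> is orthogonal to
    that vector, so its form value is the one of \<open>B\<close> at \<open>z\<close> minus the
    projected part, and it is nonnegative.\<close>
  define t where "t = z k / of_real \<sigma>"
  define w where "w i = v i - t * of_bool (i = k)" for i
  have Sv: "(\<Sum>j<p. S i j * v j) = z i" if "i < p" for i
  proof -
    have "(\<Sum>j<p. S i j * v j) = (\<Sum>l<p. \<Sum>j<p. S i j * B j l * z l)"
      unfolding v_def sum_distrib_left by (subst sum.swap) (simp add: mult.assoc)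
    also have "\<dots> = (\<Sum>l<p. of_bool (i = l) * z l)"
      using that by (intro sum.cong refl) (simp only: SB sum_distrib_right[symmetric] lessThan_iff)
    also have "\<dots> = z i"
      using that by (simp only: sum_of_bool_mult)
    finally show ?thesis .
  qed
  have Q: "(\<Sum>i<p. cnj (z i) * v i) = sesq p B z"
    by (simp add: sesq_def v_def sum_distrib_left mult.assoc)
  have Q': "(\<Sum>i<p. cnj (v i) * z i) = sesq p B z"
    using arg_cong[OF Q, of cnj] sesq_B_real[of z] by (simp add: Reals_cnj_iff mult.commute)
  have Sw: "(\<Sum>j<p. S i j * w j) = z i - t * S i k" if "i < p" for i
  proof -
    have "(\<Sum>j<p. S i j * w j) = (\<Sum>j<p. S i j * v j) - t * (\<Sum>j<p. S i j * of_bool (j = k))"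
      unfolding w_def
      by (simp only: right_diff_distrib sum_subtractf sum_distrib_left mult.left_commute)
    then show ?thesis using that k by (simp only: Sv sum_of_bool_mult)
  qed
  have vS: "(\<Sum>i<p. cnj (v i) * S i k) = cnj (z k)"
  proof -
    have "(\<Sum>i<p. cnj (v i) * S i k) = (\<Sum>i<p. cnj (S k i * v i))"
      using k by (intro sum.cong refl) (subst herm, auto)
    then show ?thesis using Sv[OF k] by (simp only: cnj_sum[symmetric])
  qed
  have "sesq p S w = (\<Sum>i<p. cnj (w i) * (\<Sum>j<p. S i j * w j))"
    by (simp add: sesq_def sum_distrib_left mult.assoc)
  also have "\<dots> = (\<Sum>i<p. cnj (w i) * (z i - t * S i k))"
    by (intro sum.cong refl) (simp only: Sw lessThan_iff)
  also have "\<dots> = (\<Sum>i<p. cnj (v i) * z i - t * (cnj (v i) * S i k)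
      - cnj t * (of_bool (i = k) * (z i - t * S i k)))"
  proof (intro sum.cong refl)
    fix i
    have cw: "cnj (w i) = cnj (v i) - cnj t * of_bool (i = k)"
      by (simp add: w_def of_bool_def)
    show "cnj (w i) * (z i - t * S i k) = cnj (v i) * z i - t * (cnj (v i) * S i k)
        - cnj t * (of_bool (i = k) * (z i - t * S i k))"
      unfolding cw by (simp only: algebra_simps)
  qed
  also have "\<dots> = (\<Sum>i<p. cnj (v i) * z i) - t * (\<Sum>i<p. cnj (v i) * S i k)
      - cnj t * (\<Sum>i<p. of_bool (i = k) * (z i - t * S i k))"
    by (simp only: sum_subtractf sum_distrib_left)
  also have "\<dots> = sesq p B z - t * cnj (z k) - cnj t * (z k - t * S k k)"
    using k by (simp only: Q' vS sum_of_bool_mult)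
  also have "\<dots> = sesq p B z - of_real ((norm (z k))\<^sup>2 / \<sigma>)"
    using \<sigma> by (simp add: t_def complex_norm_square[symmetric] del: of_real_power)
  finally have eq: "Re (sesq p S w) = Re (sesq p B z) - (norm (z k))\<^sup>2 / \<sigma>" by simp
  have "0 \<le> Re (sesq p S w)"
  proof (cases "\<exists>i<p. w i \<noteq> 0")
    case True
    then show ?thesis using pos less_imp_le by blast
  next
    case False
    then show ?thesis by (simp add: sesq_def)
  qed
  then show ?thesis
    using eq \<sigma>(2) unfolding \<sigma>_def[symmetric] by (simp add: field_simps)
qed

lemma B_diag:
  assumes "k < p"
  shows "B k k = of_real (Re (B k k))" "0 < Re (B k k)"
proof -
  show "B k k = of_real (Re (B k k))"
    using B_herm[OF assms assms] by (simp add: complex_eq_iff)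
  have "1 \<le> Re (S k k) * Re (B k k)"
    using norm_sq_le_sesq_B[OF assms, of "\<lambda>i. of_bool (i = k)"] by (simp add: sesq_unit[OF assms])
  then show "0 < Re (B k k)"
    using S_diag(2)[OF assms] by (smt (verit) mult_nonneg_nonpos)
qed

text \<open>Average of the coordinatewise bounds \<open>norm_sq_le_sesq_B\<close>. It is the
  coercivity that lets a product of planar Gaussians dominate the density, obtained without
  diagonalisation.\<close>

lemma sesq_B_lower_bound:
  "(\<Sum>k<p. (norm (z k))\<^sup>2 / (real p * Re (S k k))) \<le> Re (sesq p B z)"
proof (cases "p = 0")
  case False
  have "(\<Sum>k<p. (norm (z k))\<^sup>2 / (real p * Re (S k k))) \<le> (\<Sum>k<p. Re (sesq p B z) / real p)"
  proof (rule sum_mono)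
    fix k assume "k \<in> {..<p}"
    then have "k < p" by simp
    from norm_sq_le_sesq_B[OF this, of z] S_diag(2)[OF this] False
    show "(norm (z k))\<^sup>2 / (real p * Re (S k k)) \<le> Re (sesq p B z) / real p"
      by (simp add: field_simps)
  qed
  then show ?thesis using False by simp
qed (simp add: sesq_def)

text \<open>Isolates coordinate \<open>k\<close>. The two cross terms are conjugate because
  \<open>B\<close> is Hermitian, so the part depending on \<open>y\<close> has exactly the shape of
  the exponent in \<open>gauss_monomial\<close>.\<close>

lemma sesq_fun_upd:
  assumes k: "k < p"
  shows "sesq p B (x(k := y)) = B k k * (y * cnj y)
     + (\<Sum>j\<in>{..<p} - {k}. B k j * x j) * cnj y + cnj (\<Sum>j\<in>{..<p} - {k}. B k j * x j) * y
     + (\<Sum>i\<in>{..<p} - {k}. \<Sum>j\<in>{..<p} - {k}. cnj (x i) * B i j * x j)"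
proof -
  have split: "(\<Sum>i<p. f i) = f k + (\<Sum>i\<in>{..<p} - {k}. f i)" for f :: "nat \<Rightarrow> complex"
    using k by (simp add: sum.remove)
  have "(\<Sum>i\<in>{..<p} - {k}. cnj (x i) * B i k * y) = cnj (\<Sum>j\<in>{..<p} - {k}. B k j * x j) * y"
    unfolding cnj_sum sum_distrib_right
    using k by (intro sum.cong refl) (subst B_herm, auto)
  then show ?thesis
    unfolding sesq_def split
    by (simp add: sum.distrib sum_distrib_left sum_distrib_right algebra_simps)
qed

end

subsection \<open>Stein's identity\<close>

definition cmono :: "nat \<Rightarrow> (nat \<Rightarrow> nat) \<Rightarrow> (nat \<Rightarrow> nat) \<Rightarrow> (nat \<Rightarrow> complex) \<Rightarrow> complex" where
  "cmono p n m z = (\<Prod>j<p. z j ^ n j * cnj (z j) ^ m j)"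

lemma cmono_Suc:
  assumes "j < p"
  shows "cmono p (n(j := Suc (n j))) m z = z j * cmono p n m z"
proof -
  have "(\<Prod>i\<in>{..<p} - {j}. z i ^ (n(j := Suc (n j))) i * cnj (z i) ^ m i)
      = (\<Prod>i\<in>{..<p} - {j}. z i ^ n i * cnj (z i) ^ m i)"
    by (intro prod.cong) auto
  then show ?thesis
    using assms unfolding cmono_def
    by (subst (1 2) prod.remove[of "{..<p}" j]) (simp_all add: ac_simps)
qed

lemma cmono_fun_upd:
  assumes "k < p"
  shows "cmono p n m (x(k := y)) = y ^ n k * cnj y ^ m k * (\<Prod>j\<in>{..<p} - {k}. x j ^ n j * cnj (x j) ^ m j)"
proof -
  have "(\<Prod>j\<in>{..<p} - {k}. (x(k := y)) j ^ n j * cnj ((x(k := y)) j) ^ m j)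
      = (\<Prod>j\<in>{..<p} - {k}. x j ^ n j * cnj (x j) ^ m j)"
    by (intro prod.cong) auto
  then show ?thesis
    using assms unfolding cmono_def by (subst prod.remove[of "{..<p}" k]) simp_all
qed

lemma measurable_cnj [measurable]: "cnj \<in> borel_measurable borel"
  by (intro borel_measurable_continuous_onI continuous_intros)

lemma measurable_lebesgue_Cp_component [measurable]:
  "i < p \<Longrightarrow> (\<lambda>z. z i) \<in> borel_measurable (lebesgue_Cp p)"
  unfolding lebesgue_Cp_def
  by (rule measurable_component_singleton[of i "{..<p}" "\<lambda>_. lborel", unfolded measurable_lborel1]) simp

lemma measurable_sesq [measurable]: "sesq p A \<in> borel_measurable (lebesgue_Cp p)"
  unfolding sesq_def by measurable

lemma measurable_cmono [measurable]: "cmono p n m \<in> borel_measurable (lebesgue_Cp p)"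
  unfolding cmono_def by measurable

interpretation lborel_complex: product_sigma_finite "\<lambda>_::nat. lborel :: complex measure" ..

lemma integral_lebesgue_Cp_split:
  fixes f :: "(nat \<Rightarrow> complex) \<Rightarrow> complex"
  assumes "k < p" "integrable (lebesgue_Cp p) f"
  shows "(LINT z|lebesgue_Cp p. f z) = (LINT x|PiM ({..<p} - {k}) (\<lambda>_. lborel). (LINT y|lborel. f (x(k := y))))"
proof -
  have eq: "insert k ({..<p} - {k}) = {..<p}" using assms(1) by auto
  show ?thesis
    using lborel_complex.product_integral_insert[of "{..<p} - {k}" k f] assms(2)
    unfolding eq lebesgue_Cp_def by simp
qed

context hpd_inverse
begin

definition gaussian_moment :: "(nat \<Rightarrow> nat) \<Rightarrow> (nat \<Rightarrow> nat) \<Rightarrow> complex" where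
  "gaussian_moment n m = (LINT z|lebesgue_Cp p. cmono p n m z * exp (- sesq p B z))"

text \<open>By \<open>sesq_B_lower_bound\<close> the integrand is dominated by a product of Gaussian
  monomials with \<open>c = 0\<close>, one per coordinate, and such a product is integrable factor
  by factor.\<close>

lemma integrable_cmono_gaussian:
  "integrable (lebesgue_Cp p) (\<lambda>z. cmono p n m z * exp (- sesq p B z))"
proof (rule Bochner_Integration.integrable_bound)
  define lam where "lam k = 1 / (real p * Re (S k k))" for k
  have lam: "0 < lam k" if "k < p" for k
    using S_diag(2)[OF that] that by (simp add: lam_def)
  show "integrable (lebesgue_Cp p) (\<lambda>z. \<Prod>k<p. gauss_monomial (lam k) 0 (n k) (m k) (z k))"
    unfolding lebesgue_Cp_def
    by (intro lborel_complex.product_integrable_prod integrable_gauss_monomial lam) auto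
  show "AE z in lebesgue_Cp p. norm (cmono p n m z * exp (- sesq p B z))
      \<le> norm (\<Prod>k<p. gauss_monomial (lam k) 0 (n k) (m k) (z k))"
  proof (rule AE_I2)
    fix z
    have "norm (gauss_monomial (lam k) 0 (n k) (m k) (z k))
        = norm (z k ^ n k * cnj (z k) ^ m k) * exp (- ((norm (z k))\<^sup>2 / (real p * Re (S k k))))" for k
      by (simp add: gauss_monomial_def lam_def norm_mult complex_norm_square[symmetric] del: of_real_power)
    then have "norm (\<Prod>k<p. gauss_monomial (lam k) 0 (n k) (m k) (z k))
        = norm (cmono p n m z) * exp (- (\<Sum>k<p. (norm (z k))\<^sup>2 / (real p * Re (S k k))))"
      unfolding cmono_def prod_norm[symmetric] sum_negf[symmetric] exp_sum[OF finite_lessThan]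
        prod.distrib[symmetric] by simp
    then show "norm (cmono p n m z * exp (- sesq p B z))
        \<le> norm (\<Prod>k<p. gauss_monomial (lam k) 0 (n k) (m k) (z k))"
      using sesq_B_lower_bound[of z] by (simp add: norm_mult mult_left_mono)
  qed
qed measurable

text \<open>The exponential is real, so conjugation only exchanges the two families of exponents.
  This handles moments with \<open>n = 0\<close>, where the recursion applies only to the conjugate
  moment.\<close>

lemma gaussian_moment_cnj: "gaussian_moment m n = cnj (gaussian_moment n m)"
proof -
  have "cnj (sesq p B z) = sesq p B z" for z
    using sesq_B_real[of z] by (simp add: Reals_cnj_iff)
  then have "cnj (cmono p n m z * exp (- sesq p B z)) = cmono p m n z * exp (- sesq p B z)" for z
    by (simp add: cmono_def exp_cnj mult.commute)
  then show ?thesis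
    using Bochner_Integration.integral_cnj[of "lebesgue_Cp p" "\<lambda>z. cmono p n m z * exp (- sesq p B z)"]
    unfolding gaussian_moment_def by (simp only:)
qed

text \<open>Integrating out the \<open>k\<close>-th coordinate first reduces Stein's identity to the plane.\<close>
lemma gaussian_moment_stein:
  assumes k: "k < p"
  shows "(\<Sum>j<p. B k j * gaussian_moment (n(j := Suc (n j))) m)
    = of_nat (m k) * gaussian_moment n (m(k := m k - 1))"
proof -
  \<comment> \<open>\<open>f\<close> is the derivative of the whole integrand in the conjugate of
    \<open>z k\<close>: the monomial loses one such factor, and the exponential contributes minus
    the k-th entry of \<open>B\<close> applied to \<open>z\<close>.\<close>
  define f where "f z = of_nat (m k) * (cmono p n (m(k := m k - 1)) z * exp (- sesq p B z))
    - (\<Sum>j<p. B k j * (cmono p (n(j := Suc (n j))) m z * exp (- sesq p B z)))" for z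
  have int: "integrable (lebesgue_Cp p) f"
    unfolding f_def
    by (intro Bochner_Integration.integrable_diff Bochner_Integration.integrable_sum
        integrable_mult_right integrable_cmono_gaussian)
  define b where "b = Re (B k k)"
  have b: "0 < b" "B k k = of_real b" using B_diag[OF k] by (auto simp: b_def)
  have "(LINT y|lborel. f (x(k := y))) = 0" for x
  proof -
    define P where "P = (\<Prod>j\<in>{..<p} - {k}. x j ^ n j * cnj (x j) ^ m j)"
    define c where "c = (\<Sum>j\<in>{..<p} - {k}. B k j * x j)"
    define d where "d = (\<Sum>i\<in>{..<p} - {k}. \<Sum>j\<in>{..<p} - {k}. cnj (x i) * B i j * x j)"
    have "f (x(k := y)) = P * exp (- d) * gauss_dzbar b c (n k) (m k) y" for y
    proof -
      have e: "exp (- sesq p B (x(k := y)))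
          = exp (- (of_real b * (y * cnj y) + c * cnj y + cnj c * y)) * exp (- d)"
        unfolding sesq_fun_upd[OF k] c_def[symmetric] d_def[symmetric] b(2)
        by (simp only: mult_exp_exp add.assoc minus_add_distrib)
      have P': "(\<Prod>j\<in>{..<p} - {k}. x j ^ n j * cnj (x j) ^ (m(k := m k - 1)) j) = P"
        unfolding P_def by (intro prod.cong) auto
      have c1: "cmono p n (m(k := m k - 1)) (x(k := y)) = y ^ n k * cnj y ^ (m k - 1) * P"
        using cmono_fun_upd[OF k, of n "m(k := m k - 1)" x y] unfolding P' by simp
      have c2: "cmono p n m (x(k := y)) = y ^ n k * cnj y ^ m k * P"
        using cmono_fun_upd[OF k] by (simp add: P_def)
      have lin: "(\<Sum>j<p. B k j * (x(k := y)) j) = of_real b * y + c"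
        using k by (simp add: sum.remove[of "{..<p}" k] b(2) c_def)
      have sm: "(\<Sum>j<p. B k j * (cmono p (n(j := Suc (n j))) m (x(k := y)) * exp (- sesq p B (x(k := y)))))
         = (\<Sum>j<p. B k j * (x(k := y)) j) * cmono p n m (x(k := y)) * exp (- sesq p B (x(k := y)))"
        unfolding sum_distrib_right by (intro sum.cong refl) (simp add: cmono_Suc del: fun_upd_apply)
      show ?thesis
        unfolding f_def unfolding sm unfolding lin c1 c2 e gauss_dzbar_def gauss_monomial_def
        by (simp add: algebra_simps)
    qed
    then show ?thesis
      using integral_gauss_dzbar[OF b(1), of c "n k" "m k"] by simp
  qed
  then have "(LINT z|lebesgue_Cp p. f z) = 0"
    by (subst integral_lebesgue_Cp_split[OF k int]) simp
  moreover have "(LINT z|lebesgue_Cp p. f z) = of_nat (m k) * gaussian_moment n (m(k := m k - 1))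
      - (\<Sum>j<p. B k j * gaussian_moment (n(j := Suc (n j))) m)"
  proof -
    have 1: "integrable (lebesgue_Cp p) (\<lambda>z. c * (cmono p n m z * exp (- sesq p B z)))" for c n m
      by (intro integrable_mult_right integrable_cmono_gaussian)
    have 2: "(LINT z|lebesgue_Cp p. c * (cmono p n m z * exp (- sesq p B z))) = c * gaussian_moment n m" for c n m
      unfolding gaussian_moment_def by (rule integral_mult_right_zero)
    have 3: "integrable (lebesgue_Cp p)
        (\<lambda>z. \<Sum>j<p. B k j * (cmono p (n(j := Suc (n j))) m z * exp (- sesq p B z)))"
      by (intro Bochner_Integration.integrable_sum 1)
    show ?thesis
      unfolding f_def Bochner_Integration.integral_diff[OF 1 3] Bochner_Integration.integral_sum[OF 1] 2 ..
  qed
  ultimately show ?thesis by simp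
qed

text \<open>The Wick recursion. Weighting Stein's identity for index \<open>k\<close> by
  \<open>S h k\<close> and summing over \<open>k\<close> produces the product of \<open>S\<close>
  and \<open>B\<close>, which isolates the index \<open>h\<close>.\<close>

lemma gaussian_moment_Suc:
  assumes h: "h < p"
  shows "gaussian_moment (n(h := Suc (n h))) m
    = (\<Sum>k<p. S h k * (of_nat (m k) * gaussian_moment n (m(k := m k - 1))))"
proof -
  have "(\<Sum>k<p. S h k * (of_nat (m k) * gaussian_moment n (m(k := m k - 1))))
      = (\<Sum>k<p. S h k * (\<Sum>j<p. B k j * gaussian_moment (n(j := Suc (n j))) m))"
    by (intro sum.cong refl) (simp add: gaussian_moment_stein)
  also have "\<dots> = (\<Sum>j<p. (\<Sum>k<p. S h k * B k j) * gaussian_moment (n(j := Suc (n j))) m)"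
    unfolding sum_distrib_left sum_distrib_right by (subst sum.swap) (simp add: mult.assoc)
  also have "\<dots> = (\<Sum>j<p. of_bool (h = j) * gaussian_moment (n(j := Suc (n j))) m)"
    using h by (intro sum.cong refl) (simp only: SB lessThan_iff)
  also have "\<dots> = gaussian_moment (n(h := Suc (n h))) m"
    using h by (simp only: sum_of_bool_mult)
  finally show ?thesis by simp
qed

end

subsection \<open>Normalisation\<close>

text \<open>Schur complement of the last diagonal entry: the form that remains once the last
  coordinate has been integrated out.\<close>

definition schur_last :: "nat \<Rightarrow> (nat \<Rightarrow> nat \<Rightarrow> complex) \<Rightarrow> nat \<Rightarrow> nat \<Rightarrow> complex" where
  "schur_last p B i j = B i j - B i p * B p j / B p p"

text \<open>Marginalising a Gaussian just truncates its covariance. In the inverse relations the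
  separated last summand cancels against the Schur correction; positivity follows by extending a
  vector by 0.\<close>

lemma hpd_inverse_schur_last:
  assumes "hpd_inverse (Suc p) S B"
  shows "hpd_inverse p S (schur_last p B)"
proof -
  interpret hpd_inverse "Suc p" S B by fact
  have b: "B p p \<noteq> 0" using B_diag(2)[of p] by auto
  have SB': "(\<Sum>k<p. S i k * B k j) = of_bool (i = j) - S i p * B p j" if "i < Suc p" "j < Suc p" for i j
    using SB[OF that] by (simp add: algebra_simps)
  have BS': "(\<Sum>k<p. B i k * S k j) = of_bool (i = j) - B i p * S p j" if "i < Suc p" "j < Suc p" for i j
    using BS[OF that] by (simp add: algebra_simps)
  show ?thesis
  proof
    show "S i j = cnj (S j i)" if "i < p" "j < p" for i j
      using herm[of i j] that by simp
    show "0 < Re (sesq p S v)" if "i < p" "v i \<noteq> 0" for v i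
    proof -
      have "sesq (Suc p) S (v(p := 0)) = sesq p S v"
        by (simp add: sesq_def)
      then show ?thesis
        using pos[of i "v(p := 0)"] that by simp
    qed
    show "(\<Sum>k<p. S i k * schur_last p B k j) = of_bool (i = j)" if "i < p" "j < p" for i j
    proof -
      have "(\<Sum>k<p. S i k * schur_last p B k j)
          = (\<Sum>k<p. S i k * B k j) - (\<Sum>k<p. S i k * B k p) * B p j / B p p"
        by (simp add: schur_last_def right_diff_distrib sum_subtractf sum_distrib_right
            sum_divide_distrib mult.assoc)
      also have "\<dots> = of_bool (i = j)"
        using that b by (simp add: SB')
      finally show ?thesis .
    qed
    show "(\<Sum>k<p. schur_last p B i k * S k j) = of_bool (i = j)" if "i < p" "j < p" for i j
    proof -
      have "(\<Sum>k<p. schur_last p B i k * S k j)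
          = (\<Sum>k<p. B i k * S k j) - B i p / B p p * (\<Sum>k<p. B p k * S k j)"
        by (simp add: schur_last_def left_diff_distrib sum_subtractf sum_distrib_left
            sum_divide_distrib mult.assoc)
      also have "\<dots> = of_bool (i = j)"
        using that b by (simp add: BS')
      finally show ?thesis .
    qed
  qed
qed

text \<open>Cramer's rule for the last diagonal entry of the inverse; its cofactor is the leading
  minor, with sign +1.\<close>

lemma (in hpd_inverse) det_leading_minor:
  assumes "p = Suc q"
  shows "B q q * Determinant.det (mat p p (\<lambda>(i, j). S i j)) = Determinant.det (mat q q (\<lambda>(i, j). S i j))"
proof -
  define A where "A = mat p p (\<lambda>(i, j). S i j)"
  define C where "C = mat p p (\<lambda>(i, j). B i j)"
  have A: "A \<in> carrier_mat p p" and C: "C \<in> carrier_mat p p" by (auto simp: A_def C_def)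
  have CA: "C * A = 1\<^sub>m p"
    using BS by (intro eq_matI) (auto simp: A_def C_def scalar_prod_def atLeast0LessThan)
  have "adj_mat A = (C * A) * adj_mat A"
    using adj_mat(1)[OF A] by (simp add: CA)
  also have "\<dots> = C * (Determinant.det A \<cdot>\<^sub>m 1\<^sub>m p)"
    using assoc_mult_mat[OF C A adj_mat(1)[OF A]] adj_mat(2)[OF A] by simp
  also have "\<dots> = Determinant.det A \<cdot>\<^sub>m C"
    using C by (simp add: mult_smult_distrib[OF C one_carrier_mat])
  finally have "adj_mat A $$ (q, q) = Determinant.det A * B q q"
    using assms by (simp add: C_def)
  moreover have "adj_mat A $$ (q, q) = Determinant.det (mat_delete A q q)"
    using assms A by (simp add: adj_mat_def cofactor_def)
  moreover have "mat_delete A q q = mat q q (\<lambda>(i, j). S i j)"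
    using assms by (intro eq_matI) (auto simp: mat_delete_def A_def)
  ultimately show ?thesis
    by (simp add: A_def mult.commute)
qed

lemma integral_gaussian_complex_shift:
  fixes c :: complex
  assumes "0 < b"
  shows "(LINT y|lborel. exp (- (of_real b * ((y + c) * cnj (y + c))))) = of_real (pi / b)"
proof -
  have eq: "exp (- (of_real b * (z * cnj z))) = complex_of_real (exp (- b * (norm z)\<^sup>2))" for z
    by (simp add: complex_norm_square[symmetric] exp_of_real[symmetric] del: of_real_power)
  have "(LINT y|lborel. exp (- (of_real b * ((y + c) * cnj (y + c)))))
      = (LINT y|distr lborel borel ((+) c). exp (- (of_real b * (y * cnj y))))"
    by (subst integral_distr) (auto simp: add.commute)
  also have "\<dots> = (LINT y|lborel. complex_of_real (exp (- b * (norm (y::complex))\<^sup>2)))"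
    by (simp only: lborel_distr_plus eq)
  also have "\<dots> = of_real (pi / b)"
    using has_bochner_integral_integral_eq[OF gaussian_complex[OF assms]]
    by (simp only: integral_complex_of_real)
  finally show ?thesis .
qed

text \<open>Induction on the dimension. Completing the square in the last coordinate splits off a
  shifted planar Gaussian with integral \<open>pi / b\<close> and leaves the Schur complement;
  \<open>det_leading_minor\<close> converts \<open>1 / b\<close> into the ratio of
  determinants.\<close>

lemma integral_exp_sesq:
  assumes "hpd_inverse p S B"
  shows "(LINT z|lebesgue_Cp p. exp (- sesq p B z))
    = of_real pi ^ p * Determinant.det (mat p p (\<lambda>(i, j). S i j))"
  using assms
proof (induction p arbitrary: B)
  case 0
  show ?case
    by (simp add: lebesgue_Cp_def PiM_empty sesq_def lebesgue_integral_count_space_finite)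
next
  case (Suc p)
  interpret hpd_inverse "Suc p" S B by fact
  define b where "b = Re (B p p)"
  have b: "0 < b" "B p p = of_real b" using B_diag[of p] by (auto simp: b_def)
  define c where "c x = (\<Sum>j<p. B p j * x j)" for x
  have eq: "sesq (Suc p) B (x(p := y)) = of_real b * ((y + c x / of_real b) * cnj (y + c x / of_real b))
      + sesq p (schur_last p B) x" for x y
  proof -
    have lt: "{..<Suc p} - {p} = {..<p}" by auto
    have cc: "cnj (c x) = (\<Sum>i<p. cnj (x i) * B i p)"
      unfolding c_def cnj_sum by (intro sum.cong refl) (subst B_herm, auto)
    have "sesq p (schur_last p B) x = sesq p B x - (\<Sum>i<p. cnj (x i) * B i p) * (\<Sum>j<p. B p j * x j) / B p p"
      unfolding sum_product by (simp add: sesq_def schur_last_def algebra_simps sum_subtractf sum_divide_distrib)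
    then have sch: "sesq p (schur_last p B) x = sesq p B x - cnj (c x) * c x / of_real b"
      by (simp only: cc) (simp only: c_def b)
    have sq: "of_real b * ((y + u / of_real b) * cnj (y + u / of_real b))
        = of_real b * (y * cnj y) + u * cnj y + cnj u * y + cnj u * u / of_real b" for u
      using b(1) by (simp add: divide_simps) (simp add: algebra_simps)
    show ?thesis
      using sesq_fun_upd[of p x y]
      unfolding lt c_def[symmetric] sesq_def[of p B x, symmetric] b(2) sch sq by simp
  qed
  have int: "integrable (lebesgue_Cp (Suc p)) (\<lambda>z. exp (- sesq (Suc p) B z))"
    using integrable_cmono_gaussian[of "\<lambda>_. 0" "\<lambda>_. 0"] by (simp add: cmono_def)
  have "(LINT y|lborel. exp (- sesq (Suc p) B (x(p := y)))) = of_real (pi / b) * exp (- sesq p (schur_last p B) x)" for x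
  proof -
    have "exp (- sesq (Suc p) B (x(p := y)))
      = exp (- (of_real b * ((y + c x / of_real b) * cnj (y + c x / of_real b)))) * exp (- sesq p (schur_last p B) x)" for y
      unfolding eq by (simp only: mult_exp_exp minus_add_distrib)
    then show ?thesis
      using integral_gaussian_complex_shift[OF b(1), of "c x / of_real b"] by (simp only: integral_mult_left_zero)
  qed
  moreover have "{..<Suc p} - {p} = {..<p}" by auto
  ultimately have "(LINT z|lebesgue_Cp (Suc p). exp (- sesq (Suc p) B z))
      = (LINT x|lebesgue_Cp p. of_real (pi / b) * exp (- sesq p (schur_last p B) x))"
    unfolding lebesgue_Cp_def[of p] by (subst integral_lebesgue_Cp_split[of p, OF _ int]) simp_all
  also have "\<dots> = of_real (pi / b) * (of_real pi ^ p * Determinant.det (mat p p (\<lambda>(i, j). S i j)))"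
    using Suc.IH[OF hpd_inverse_schur_last[OF Suc.prems]] by (simp only: integral_mult_right_zero)
  also have "\<dots> = of_real pi ^ Suc p * Determinant.det (mat (Suc p) (Suc p) (\<lambda>(i, j). S i j))"
    using det_leading_minor[OF refl, symmetric] b by simp
  finally show ?case .
qed

subsection \<open>Contingency tables\<close>

text \<open>Entries outside the square are fixed to 0, as in \<open>I_set\<close>, so that the two
  sets can be compared as sets of functions.\<close>

definition tables :: "nat \<Rightarrow> (nat \<Rightarrow> nat) \<Rightarrow> (nat \<Rightarrow> nat) \<Rightarrow> (nat \<Rightarrow> nat \<Rightarrow> nat) set" where
  "tables p n m = {a. (\<forall>i j. p \<le> i \<or> p \<le> j \<longrightarrow> a i j = 0)
     \<and> (\<forall>i<p. (\<Sum>j<p. a i j) = n i) \<and> (\<forall>j<p. (\<Sum>i<p. a i j) = m j)}"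

lemma finite_tables: "finite (tables p n m)"
proof (rule finite_subset)
  let ?F = "\<lambda>g i j. if i < p \<and> j < p then g (i, j) else (0::nat)"
  let ?P = "PiE ({..<p} \<times> {..<p}) (\<lambda>_. {..\<Sum>i<p. n i})"
  show "finite (?F ` ?P)"
    by (intro finite_imageI finite_PiE) auto
  show "tables p n m \<subseteq> ?F ` ?P"
  proof
    fix a assume a: "a \<in> tables p n m"
    have le: "a i j \<le> (\<Sum>i<p. n i)" if "i < p" "j < p" for i j
    proof -
      have "a i j \<le> (\<Sum>j<p. a i j)" using that by (intro member_le_sum) auto
      also have "\<dots> = n i" using a that by (auto simp: tables_def)
      also have "\<dots> \<le> (\<Sum>i<p. n i)" using that by (intro member_le_sum) auto
      finally show ?thesis .
    qed
    have "a = ?F (restrict (\<lambda>(i, j). a i j) ({..<p} \<times> {..<p}))"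
      using a by (auto simp: tables_def fun_eq_iff not_less)
    moreover have "restrict (\<lambda>(i, j). a i j) ({..<p} \<times> {..<p}) \<in> ?P"
      using le by auto
    ultimately show "a \<in> ?F ` ?P" by blast
  qed
qed

definition table_weight :: "nat \<Rightarrow> (nat \<Rightarrow> nat \<Rightarrow> complex) \<Rightarrow> (nat \<Rightarrow> nat \<Rightarrow> nat) \<Rightarrow> complex" where
  "table_weight p S a = (\<Prod>h<p. \<Prod>k<p. S h k ^ a h k / of_nat (fact (a h k)))"

definition table_sum :: "nat \<Rightarrow> (nat \<Rightarrow> nat \<Rightarrow> complex) \<Rightarrow> (nat \<Rightarrow> nat) \<Rightarrow> (nat \<Rightarrow> nat) \<Rightarrow> complex" where
  "table_sum p S n m = (\<Sum>a\<in>tables p n m. table_weight p S a)"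

definition incr :: "nat \<Rightarrow> nat \<Rightarrow> (nat \<Rightarrow> nat \<Rightarrow> nat) \<Rightarrow> nat \<Rightarrow> nat \<Rightarrow> nat" where
  "incr h k a i j = (if i = h \<and> j = k then Suc (a i j) else a i j)"

definition decr :: "nat \<Rightarrow> nat \<Rightarrow> (nat \<Rightarrow> nat \<Rightarrow> nat) \<Rightarrow> nat \<Rightarrow> nat \<Rightarrow> nat" where
  "decr h k a i j = (if i = h \<and> j = k then a i j - 1 else a i j)"

lemma prod_scale_one_factor:
  fixes f g :: "'a \<Rightarrow> 'b::comm_monoid_mult"
  assumes "finite A" "x \<in> A" "f x = c * g x" "\<And>i. i \<in> A \<Longrightarrow> i \<noteq> x \<Longrightarrow> f i = g i"
  shows "prod f A = c * prod g A"
proof -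
  have "prod f (A - {x}) = prod g (A - {x})"
    using assms(4) by (intro prod.cong) auto
  then show ?thesis
    using assms(1-3) by (simp add: prod.remove[of A x] mult.assoc)
qed

text \<open>Raising one exponent by 1 multiplies the weight by \<open>S h k\<close> and divides it
  by the new entry, which the factor on the left cancels.\<close>

lemma table_weight_incr:
  assumes "h < p" "k < p"
  shows "of_nat (incr h k a h k) * table_weight p S (incr h k a) = S h k * table_weight p S a"
proof -
  have "table_weight p S (incr h k a) = S h k / of_nat (Suc (a h k)) * table_weight p S a"
    unfolding table_weight_def
  proof (rule prod_scale_one_factor[where x = h])
    show "(\<Prod>k'<p. S h k' ^ incr h k a h k' / of_nat (fact (incr h k a h k')))
        = S h k / of_nat (Suc (a h k)) * (\<Prod>k'<p. S h k' ^ a h k' / of_nat (fact (a h k')))"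
      by (rule prod_scale_one_factor[where x = k]) (use assms in \<open>simp_all add: incr_def algebra_simps\<close>)
  qed (use assms in \<open>simp_all add: incr_def\<close>)
  then show ?thesis
    by (simp add: incr_def del: of_nat_Suc)
qed

lemma sum_incr_row:
  assumes "k < p"
  shows "(\<Sum>j<p. incr h k a i j) = (\<Sum>j<p. a i j) + (if i = h then 1 else 0)"
proof -
  have "(\<Sum>j<p. incr h k a i j) = (\<Sum>j<p. a i j + (if j = k then if i = h then 1 else 0 else 0))"
    by (intro sum.cong) (auto simp: incr_def)
  then show ?thesis using assms by (simp add: sum.distrib)
qed

lemma sum_incr_col:
  assumes "h < p"
  shows "(\<Sum>i<p. incr h k a i j) = (\<Sum>i<p. a i j) + (if j = k then 1 else 0)"
proof -
  have "(\<Sum>i<p. incr h k a i j) = (\<Sum>i<p. a i j + (if i = h then if j = k then 1 else 0 else 0))"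
    by (intro sum.cong) (auto simp: incr_def)
  then show ?thesis using assms by (simp add: sum.distrib)
qed

text \<open>The condition \<open>0 < m k\<close> keeps \<open>m k - 1\<close> a true predecessor
  rather than a truncated difference.\<close>

lemma incr_in_tables_iff:
  assumes "h < p" "k < p" "0 < m k"
  shows "incr h k a \<in> tables p (n(h := Suc (n h))) m \<longleftrightarrow> a \<in> tables p n (m(k := m k - 1))"
proof -
  have "(\<forall>i j. p \<le> i \<or> p \<le> j \<longrightarrow> incr h k a i j = 0) \<longleftrightarrow> (\<forall>i j. p \<le> i \<or> p \<le> j \<longrightarrow> a i j = 0)"
    using assms(1,2) by (auto simp: incr_def)
  moreover have "(\<forall>i<p. (\<Sum>j<p. incr h k a i j) = (n(h := Suc (n h))) i) \<longleftrightarrow> (\<forall>i<p. (\<Sum>j<p. a i j) = n i)"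
    using assms(2) by (auto simp: sum_incr_row)
  moreover have "(\<forall>j<p. (\<Sum>i<p. incr h k a i j) = m j) \<longleftrightarrow> (\<forall>j<p. (\<Sum>i<p. a i j) = (m(k := m k - 1)) j)"
    using assms(1,3) by (auto simp: sum_incr_col)
  ultimately show ?thesis
    unfolding tables_def mem_Collect_eq by simp
qed

text \<open>The counterpart of the Wick recursion. The factor \<open>Suc (n h)\<close> is the sum of
  row \<open>h\<close> and is distributed over its entries; an entry times the weight is then
  \<open>S h k\<close> times the weight of the table lowered at that entry.\<close>

lemma table_sum_Suc:
  assumes h: "h < p"
  shows "of_nat (Suc (n h)) * table_sum p S (n(h := Suc (n h))) m
    = (\<Sum>k<p. if m k = 0 then 0 else S h k * table_sum p S n (m(k := m k - 1)))"
proof -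
  let ?T = "tables p (n(h := Suc (n h))) m"
  have "of_nat (Suc (n h)) * table_sum p S (n(h := Suc (n h))) m
      = (\<Sum>a\<in>?T. of_nat (\<Sum>k<p. a h k) * table_weight p S a)"
    unfolding table_sum_def sum_distrib_left
    using h by (intro sum.cong refl) (auto simp: tables_def)
  also have "\<dots> = (\<Sum>k<p. \<Sum>a\<in>?T. of_nat (a h k) * table_weight p S a)"
    unfolding of_nat_sum sum_distrib_right by (rule sum.swap)
  also have "\<dots> = (\<Sum>k<p. if m k = 0 then 0 else S h k * table_sum p S n (m(k := m k - 1)))"
  proof (intro sum.cong refl)
    fix k assume "k \<in> {..<p}"
    then have k: "k < p" by simp
    show "(\<Sum>a\<in>?T. of_nat (a h k) * table_weight p S a)
        = (if m k = 0 then 0 else S h k * table_sum p S n (m(k := m k - 1)))"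
    proof (cases "m k = 0")
      case True
      have "a h k = 0" if "a \<in> ?T" for a
        using that True h k by (auto simp: tables_def)
      then show ?thesis using True by (auto intro!: sum.neutral)
    next
      case False
      have "(\<Sum>a\<in>?T. of_nat (a h k) * table_weight p S a)
          = (\<Sum>a\<in>{a \<in> ?T. 0 < a h k}. of_nat (a h k) * table_weight p S a)"
        by (intro sum.mono_neutral_right) (auto simp: finite_tables)
      also have "\<dots> = (\<Sum>a\<in>tables p n (m(k := m k - 1)). S h k * table_weight p S a)"
      \<comment> \<open>On tables with a positive entry at this position, raising undoes lowering;
        the tables with entry 0 there were dropped above, since they contribute nothing.\<close>
      proof (rule sum.reindex_bij_witness[where j = "decr h k" and i = "incr h k"])
        fix a assume a: "a \<in> {a \<in> ?T. 0 < a h k}"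
        show id: "incr h k (decr h k a) = a"
          using a by (auto simp: incr_def decr_def fun_eq_iff)
        then show "decr h k a \<in> tables p n (m(k := m k - 1))"
          using a incr_in_tables_iff[OF h k, of m "decr h k a" n] False by simp
        show "S h k * table_weight p S (decr h k a) = of_nat (a h k) * table_weight p S a"
          using table_weight_incr[OF h k, of "decr h k a" S] by (simp add: id)
      next
        fix a assume a: "a \<in> tables p n (m(k := m k - 1))"
        show "decr h k (incr h k a) = a"
          by (auto simp: incr_def decr_def fun_eq_iff)
        show "incr h k a \<in> {a \<in> ?T. 0 < a h k}"
          using a incr_in_tables_iff[OF h k, of m a n] False by (simp add: incr_def)
      qed
      finally show ?thesis
        using False by (simp add: table_sum_def sum_distrib_left)
    qed
  qed
  finally show ?thesis .
qed

lemma prod_fact_Suc: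
  fixes n :: "nat \<Rightarrow> nat" and h p :: nat
  assumes "h < p"
  shows "(\<Prod>i<p. fact ((n(h := Suc (n h))) i)) = of_nat (Suc (n h)) * (\<Prod>i<p. fact (n i) :: complex)"
  using assms by (intro prod_scale_one_factor[where x = h]) auto

text \<open>Induction on the total of \<open>n\<close>: after scaling by the factorials both sides
  obey the same recursion. The zeroth moment stays as an unevaluated factor, so normalisation is a
  separate matter.\<close>

lemma (in hpd_inverse) gaussian_moment_eq_table_sum:
  "gaussian_moment n m = gaussian_moment (\<lambda>_. 0) (\<lambda>_. 0)
     * ((\<Prod>i<p. fact (n i)) * (\<Prod>i<p. fact (m i)) * table_sum p S n m)"
proof (induction "\<Sum>i<p. n i" arbitrary: n m)
  case 0
  then have n: "n i = 0" if "i < p" for i using that by simp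
  show ?case
  proof (cases "\<exists>k<p. m k \<noteq> 0")
    case True
    then obtain k where k: "k < p" "m k \<noteq> 0" by blast
    \<comment> \<open>With the roles exchanged the recursion lowers \<open>n\<close>, and every
      summand carries a factor \<open>n i = 0\<close>.\<close>
    have "gaussian_moment m n = 0"
      using gaussian_moment_Suc[OF k(1), of "m(k := m k - 1)" n] k(2) n by simp
    then have "gaussian_moment n m = 0"
      using gaussian_moment_cnj[of n m] by simp
    moreover have "tables p n m = {}"
    proof (rule equals0I)
      fix a assume a: "a \<in> tables p n m"
      then have "a i k = 0" if "i < p" for i
        using n that k(1) by (auto simp: tables_def)
      then have "(\<Sum>i<p. a i k) = 0" by simp
      with a k show False by (auto simp: tables_def)
    qed
    ultimately show ?thesis by (simp add: table_sum_def)
  next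
    case False
    then have m: "m i = 0" if "i < p" for i using that by auto
    have "gaussian_moment n m = gaussian_moment (\<lambda>_. 0) (\<lambda>_. 0)"
      using n m by (simp add: gaussian_moment_def cmono_def)
    moreover have "tables p n m = {\<lambda>_ _. 0}"
    proof -
      have "a = (\<lambda>_ _. 0)" if a: "a \<in> tables p n m" for a
      proof (intro ext)
        fix i j
        show "a i j = 0"
        proof (cases "i < p \<and> j < p")
          case True
          then have "(\<Sum>j<p. a i j) = 0" using a n by (simp add: tables_def)
          then show ?thesis using True by simp
        next
          case False
          then show ?thesis using a by (auto simp: tables_def not_less)
        qed
      qed
      moreover have "(\<lambda>_ _. 0) \<in> tables p n m" using n m by (auto simp: tables_def)
      ultimately show ?thesis by blast
    qed
    ultimately show ?thesis
      using n m by (simp add: table_sum_def table_weight_def)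
  qed
next
  case (Suc N)
  then obtain h where h: "h < p" "n h \<noteq> 0"
    by (metis lessThan_iff nat.distinct(1) sum.neutral)
  define n0 where "n0 = n(h := n h - 1)"
  have n: "n = n0(h := Suc (n0 h))" using h by (simp add: n0_def)
  have "(\<Sum>i<p. n i) = Suc (\<Sum>i<p. n0 i)"
    using h by (simp add: n0_def sum.remove[of "{..<p}" h])
  with Suc.hyps(2) have N: "N = (\<Sum>i<p. n0 i)" by simp
  define G where "G = gaussian_moment (\<lambda>_. 0) (\<lambda>_. 0)"
  have "gaussian_moment n m = (\<Sum>k<p. S h k * (of_nat (m k) * gaussian_moment n0 (m(k := m k - 1))))"
    unfolding n by (rule gaussian_moment_Suc[OF h(1)])
  also have "\<dots> = (\<Sum>k<p. G * (\<Prod>i<p. fact (n0 i)) * (\<Prod>i<p. fact (m i))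
      * (if m k = 0 then 0 else S h k * table_sum p S n0 (m(k := m k - 1))))"
  proof (intro sum.cong refl)
    fix k assume "k \<in> {..<p}"
    then have k: "k < p" by simp
    have "(\<Prod>i<p. fact (m i)) = of_nat (m k) * (\<Prod>i<p. fact ((m(k := m k - 1)) i) :: complex)" if "m k \<noteq> 0"
      using prod_fact_Suc[OF k, of "m(k := m k - 1)"] that by simp
    then show "S h k * (of_nat (m k) * gaussian_moment n0 (m(k := m k - 1)))
        = G * (\<Prod>i<p. fact (n0 i)) * (\<Prod>i<p. fact (m i))
          * (if m k = 0 then 0 else S h k * table_sum p S n0 (m(k := m k - 1)))"
      using Suc.hyps(1)[OF N, of "m(k := m k - 1)"] by (simp add: G_def del: fun_upd_apply)
  qed
  also have "\<dots> = G * (\<Prod>i<p. fact (n0 i)) * (\<Prod>i<p. fact (m i)) * (of_nat (Suc (n0 h)) * table_sum p S n m)"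
    unfolding sum_distrib_left[symmetric] table_sum_Suc[OF h(1), symmetric] n[symmetric] ..
  also have "\<dots> = G * ((\<Prod>i<p. fact (n i)) * (\<Prod>i<p. fact (m i)) * table_sum p S n m)"
    using prod_fact_Suc[OF h(1), of n0] unfolding n[symmetric] by simp
  finally show ?case unfolding G_def .
qed

subsection \<open>The index set\<close>

text \<open>The upper bounds in the last column and last row bound the row and column sums. The
  lower bound at the last corner makes the total of all entries at least the total of
  \<open>n\<close>, so no row can fall short.\<close>

lemma I_set_margins:
  assumes a: "a \<in> I_set p n m"
  shows "\<And>i. i < p \<Longrightarrow> (\<Sum>j<p. a i j) = n i" "\<And>j. j < p \<Longrightarrow> (\<Sum>i<p. a i j) \<le> m j"
proof -
  have L: "int (a i j) \<le> L_bound n m a i j" and l: "l_bound p n m a i j \<le> int (a i j)" if "i < p" "j < p" for i j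
    using a that by (auto simp: I_set_def)
  have row: "(\<Sum>j<p. a i j) \<le> n i" if i: "i < p" for i
  proof -
    obtain q where q: "p = Suc q" using i by (cases p) auto
    have "int (a i q) \<le> int (n i) - (\<Sum>h<q. int (a i h))"
      using L[of i q] i q by (simp add: L_bound_def)
    then have "int (\<Sum>j<p. a i j) \<le> int (n i)" by (simp add: q)
    then show ?thesis by (simp only: of_nat_le_iff)
  qed
  show "(\<Sum>i<p. a i j) \<le> m j" if j: "j < p" for j
  proof -
    obtain q where q: "p = Suc q" using j by (cases p) auto
    have "int (a q j) \<le> int (m j) - (\<Sum>h<q. int (a h j))"
      using L[of q j] j q by (simp add: L_bound_def)
    then have "int (\<Sum>i<p. a i j) \<le> int (m j)" by (simp add: q)
    then show ?thesis by (simp only: of_nat_le_iff)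
  qed
  have total: "(\<Sum>i<p. n i) \<le> (\<Sum>i<p. \<Sum>j<p. a i j)"
  proof (cases p)
    case (Suc q)
    \<comment> \<open>At the corner no columns remain, so \<open>m\<close> drops out of the lower
      bound.\<close>
    have empty: "{q<..<Suc q} = {}" by auto
    have "(\<Sum>h\<in>{..q}. int (n h)) - (\<Sum>(h, k)\<in>({..q} \<times> {..q}) - {(q, q)}. int (a h k)) \<le> int (a q q)"
      using l[of q q] Suc by (simp add: l_bound_def empty)
    moreover have "(\<Sum>(h, k)\<in>{..q} \<times> {..q}. int (a h k))
        = int (a q q) + (\<Sum>(h, k)\<in>({..q} \<times> {..q}) - {(q, q)}. int (a h k))"
      by (subst sum.remove[of _ "(q, q)"]) auto
    ultimately have "(\<Sum>h\<le>q. int (n h)) \<le> (\<Sum>h\<le>q. \<Sum>k\<le>q. int (a h k))"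
      by (simp add: sum.cartesian_product)
    then have "int (\<Sum>i<p. n i) \<le> int (\<Sum>i<p. \<Sum>j<p. a i j)"
      by (simp add: Suc lessThan_Suc_atMost)
    then show ?thesis by (simp only: of_nat_le_iff)
  qed simp
  show "(\<Sum>j<p. a i j) = n i" if "i < p" for i
  proof (rule antisym[OF row[OF that]], rule ccontr)
    assume "\<not> n i \<le> (\<Sum>j<p. a i j)"
    then have "(\<Sum>i<p. \<Sum>j<p. a i j) < (\<Sum>i<p. n i)"
      using that row by (intro sum_strict_mono_ex1 bexI[of _ i]) auto
    with total show False by simp
  qed
qed

text \<open>Lower bound: whatever rows up to \<open>i\<close> do not place in columns up to
  \<open>j\<close> must lie in the later columns, whose capacity is the sum of their
  \<open>m\<close>. Upper bounds: partial row and column sums never exceed the margins.\<close>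

lemma tables_subset_I_set: "tables p n m \<subseteq> I_set p n m"
proof
  fix a assume a: "a \<in> tables p n m"
  then have row: "(\<Sum>j<p. a i j) = n i" and col: "(\<Sum>h<p. a h i) = m i" if "i < p" for i
    using that by (auto simp: tables_def)
  have "l_bound p n m a i j \<le> int (a i j)" if ij: "i < p" "j < p" for i j
  proof -
    have split: "{..<p} = {..j} \<union> {j<..<p}" "{..j} \<inter> {j<..<p} = {}" using ij by auto
    have "(\<Sum>h\<le>i. n h) = (\<Sum>h\<le>i. \<Sum>k<p. a h k)"
      using ij by (intro sum.cong refl) (simp add: row)
    also have "\<dots> = (\<Sum>h\<le>i. \<Sum>k\<le>j. a h k) + (\<Sum>h\<le>i. \<Sum>k\<in>{j<..<p}. a h k)"
      unfolding split(1) by (subst sum.union_disjoint) (auto simp: sum.distrib split(2))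
    also have "(\<Sum>h\<le>i. \<Sum>k\<in>{j<..<p}. a h k) = (\<Sum>k\<in>{j<..<p}. \<Sum>h\<le>i. a h k)"
      by (rule sum.swap)
    also have "\<dots> \<le> (\<Sum>k\<in>{j<..<p}. m k)"
    proof (rule sum_mono)
      fix k assume "k \<in> {j<..<p}"
      then have "(\<Sum>h<p. a h k) = m k" using col by simp
      moreover have "(\<Sum>h\<le>i. a h k) \<le> (\<Sum>h<p. a h k)"
        using ij by (intro sum_mono2) auto
      ultimately show "(\<Sum>h\<le>i. a h k) \<le> m k" by simp
    qed
    also have "(\<Sum>h\<le>i. \<Sum>k\<le>j. a h k) = a i j + (\<Sum>(h, k)\<in>({..i} \<times> {..j}) - {(i, j)}. a h k)"
      unfolding sum.cartesian_product by (subst sum.remove[of _ "(i, j)"]) auto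
    finally have "int (\<Sum>h\<le>i. n h)
        \<le> int (a i j + (\<Sum>(h, k)\<in>({..i} \<times> {..j}) - {(i, j)}. a h k) + (\<Sum>k\<in>{j<..<p}. m k))"
      by (simp only: of_nat_le_iff)
    then show ?thesis
      by (simp add: l_bound_def split_beta')
  qed
  moreover have "int (a i j) \<le> L_bound n m a i j" if ij: "i < p" "j < p" for i j
  proof -
    have "(\<Sum>h<j. a i h) + a i j = (\<Sum>h<Suc j. a i h)" by simp
    also have "\<dots> \<le> (\<Sum>h<p. a i h)" using ij by (intro sum_mono2) auto
    finally have "(\<Sum>h<j. a i h) + a i j \<le> n i" using row[OF ij(1)] by simp
    then have 1: "int ((\<Sum>h<j. a i h) + a i j) \<le> int (n i)" by (simp only: of_nat_le_iff)
    have "(\<Sum>h<i. a h j) + a i j = (\<Sum>h<Suc i. a h j)" by simp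
    also have "\<dots> \<le> (\<Sum>h<p. a h j)" using ij by (intro sum_mono2) auto
    finally have "(\<Sum>h<i. a h j) + a i j \<le> m j" using col[OF ij(2)] by simp
    then have 2: "int ((\<Sum>h<i. a h j) + a i j) \<le> int (m j)" by (simp only: of_nat_le_iff)
    from 1 2 show ?thesis by (simp add: L_bound_def)
  qed
  ultimately show "a \<in> I_set p n m"
    using a by (auto simp: I_set_def tables_def)
qed

text \<open>Rows are exact and columns are bounded; with equal totals a strict column inequality is
  impossible.\<close>

lemma I_set_eq_tables:
  assumes "(\<Sum>i<p. n i) = (\<Sum>j<p. m j)"
  shows "I_set p n m = tables p n m"
proof (rule antisym[OF _ tables_subset_I_set], rule subsetI)
  fix a assume a: "a \<in> I_set p n m"
  note row = I_set_margins(1)[OF a] and col = I_set_margins(2)[OF a]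
  have "(\<Sum>j<p. m j) = (\<Sum>i<p. \<Sum>j<p. a i j)"
    using assms row by simp
  also have "\<dots> = (\<Sum>j<p. \<Sum>i<p. a i j)" by (rule sum.swap)
  finally have total: "(\<Sum>j<p. m j) = (\<Sum>j<p. \<Sum>i<p. a i j)" .
  have "(\<Sum>i<p. a i j) = m j" if "j < p" for j
  proof (rule antisym[OF col[OF that]], rule ccontr)
    assume "\<not> m j \<le> (\<Sum>i<p. a i j)"
    then have "(\<Sum>j<p. \<Sum>i<p. a i j) < (\<Sum>j<p. m j)"
      using that col by (intro sum_strict_mono_ex1 bexI[of _ j]) auto
    with total show False by simp
  qed
  with row a show "a \<in> tables p n m" by (auto simp: tables_def I_set_def)
qed

lemma tables_eq_empty:
  assumes "(\<Sum>i<p. n i) \<noteq> (\<Sum>j<p. m j)"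
  shows "tables p n m = {}"
proof (rule equals0I)
  fix a assume a: "a \<in> tables p n m"
  have "(\<Sum>i<p. n i) = (\<Sum>i<p. \<Sum>j<p. a i j)" using a by (simp add: tables_def)
  also have "\<dots> = (\<Sum>j<p. \<Sum>i<p. a i j)" by (rule sum.swap)
  also have "\<dots> = (\<Sum>j<p. m j)" using a by (simp add: tables_def)
  finally show False using assms by simp
qed

section \<open>Summing the balance conditions over the connected components\<close>

text \<open>The elements of one \<open>T h\<close> are pairwise adjacent, so a nonempty
  \<open>T h\<close> lies in exactly one component. Hence the components partition both
  \<open>V\<close> and \<open>H\<close>, and the balance equations add up.\<close>

lemma induced_partition_sum:
  fixes n m :: "nat \<Rightarrow> nat"
  assumes fin: "finite V" "finite H"
    and T: "\<And>h. h \<in> H \<Longrightarrow> T h \<noteq> {}" "\<And>h. h \<in> H \<Longrightarrow> T h \<subseteq> V"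
    and balanced: "\<And>C. C \<in> induced_partition V H T \<Longrightarrow> (\<Sum>i\<in>{i \<in> H. T i \<subseteq> C}. n i) = (\<Sum>j\<in>C. m j)"
  shows "(\<Sum>i\<in>H. n i) = (\<Sum>j\<in>V. m j)"
proof -
  define E where "E = {(j, k). j \<in> V \<and> k \<in> V \<and> (\<exists>h\<in>H. j \<in> T h \<and> k \<in> T h)}"
  define cls where "cls x = {y \<in> V. (x, y) \<in> E\<^sup>*}" for x
  have P: "induced_partition V H T = cls ` V"
    by (auto simp: induced_partition_def cls_def E_def Let_def)
  have "sym (E\<^sup>*)" by (intro sym_rtrancl) (auto simp: E_def sym_def)
  then have cls_eq: "cls x = cls y" if "(x, y) \<in> E\<^sup>*" for x y
    unfolding cls_def using that by (meson rtrancl_trans symD)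
  have cls_self: "x \<in> cls x" if "x \<in> V" for x
    using that by (simp add: cls_def)
  have mem: "j \<in> cls x \<longleftrightarrow> j \<in> V \<and> cls j = cls x" for j x
  proof
    assume "j \<in> cls x"
    then have "j \<in> V" "(x, j) \<in> E\<^sup>*" by (simp_all add: cls_def)
    then show "j \<in> V \<and> cls j = cls x" using cls_eq by simp
  next
    assume "j \<in> V \<and> cls j = cls x"
    then show "j \<in> cls x" using cls_self by blast
  qed
  \<comment> \<open>The component containing \<open>T i\<close>, read off from an arbitrary element;
    nonemptiness makes the choice meaningful.\<close>
  define g where "g i = cls (SOME x. x \<in> T i)" for i
  have some: "(SOME x. x \<in> T i) \<in> T i" if "i \<in> H" for i
    using T(1)[OF that] by (simp add: some_in_eq)
  have sub: "T i \<subseteq> C \<longleftrightarrow> g i = C" if iC: "i \<in> H" "C \<in> cls ` V" for i C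
  proof
    assume "T i \<subseteq> C"
    then have "(SOME x. x \<in> T i) \<in> C" using some[OF iC(1)] by blast
    moreover obtain x where "C = cls x" using iC(2) by blast
    ultimately show "g i = C" using mem by (simp add: g_def)
  next
    assume "g i = C"
    moreover have "y \<in> g i" if y: "y \<in> T i" for y
    proof -
      have "((SOME x. x \<in> T i), y) \<in> E"
        using some[OF \<open>i \<in> H\<close>] T(2)[OF \<open>i \<in> H\<close>] y \<open>i \<in> H\<close> by (auto simp: E_def)
      then show ?thesis using T(2)[OF \<open>i \<in> H\<close>] y by (auto simp: g_def cls_def)
    qed
    ultimately show "T i \<subseteq> C" by blast
  qed
  have "(\<Sum>i\<in>H. n i) = (\<Sum>C\<in>cls ` V. \<Sum>i\<in>{i \<in> H. g i = C}. n i)"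
    using fin some T(2) by (intro sum.group[symmetric]) (auto simp: g_def)
  also have "\<dots> = (\<Sum>C\<in>cls ` V. \<Sum>j\<in>C. m j)"
  proof (rule sum.cong[OF refl])
    fix C assume C: "C \<in> cls ` V"
    have "{i \<in> H. g i = C} = {i \<in> H. T i \<subseteq> C}" using sub C by auto
    then show "(\<Sum>i\<in>{i \<in> H. g i = C}. n i) = (\<Sum>j\<in>C. m j)"
      using balanced C P by simp
  qed
  also have "\<dots> = (\<Sum>C\<in>cls ` V. \<Sum>j\<in>{j \<in> V. cls j = C}. m j)"
  proof (rule sum.cong[OF refl])
    fix C assume "C \<in> cls ` V"
    then obtain x where "C = cls x" by blast
    then have "C = {j \<in> V. cls j = C}" using mem by blast
    then show "(\<Sum>j\<in>C. m j) = (\<Sum>j\<in>{j \<in> V. cls j = C}. m j)" by (rule arg_cong)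
  qed
  also have "\<dots> = (\<Sum>j\<in>V. m j)"
    using fin by (intro sum.group) auto
  finally show ?thesis .
qed

section \<open>From matrices to entry functions, and the final assembly\<close>

lemma sesq_eq_scalar_prod:
  assumes "A \<in> carrier_mat p p"
  shows "scalar_prod (conjugate (Matrix.vec p z)) (A *\<^sub>v Matrix.vec p z) = sesq p (\<lambda>i j. A $$ (i, j)) z"
  using assms
  by (simp add: sesq_def scalar_prod_def atLeast0LessThan sum_distrib_left mult.assoc)

lemma hermitian_pd_det_nonzero:
  assumes "hermitian_pd p S"
  shows "Determinant.det S \<noteq> 0"
proof
  have S: "S \<in> carrier_mat p p" using assms by (simp add: hermitian_pd_def)
  assume "Determinant.det S = 0"
  then obtain v where v: "v \<in> carrier_vec p" "v \<noteq> 0\<^sub>v p" "S *\<^sub>v v = 0\<^sub>v p"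
    using det_0_iff_vec_prod_zero[OF S] by auto
  have "0 < Re (scalar_prod (conjugate v) (S *\<^sub>v v))"
    using assms v(1,2) unfolding hermitian_pd_def by blast
  with v show False by simp
qed

text \<open>The definite description needs existence, given by the adjugate divided by the
  determinant, and uniqueness, which follows from associativity.\<close>

lemma inv_mat_inverse:
  assumes S: "S \<in> carrier_mat p p" and det: "Determinant.det S \<noteq> 0"
  shows "inv_mat p S \<in> carrier_mat p p \<and> S * inv_mat p S = 1\<^sub>m p \<and> inv_mat p S * S = 1\<^sub>m p"
  unfolding inv_mat_def
proof (rule theI)
  define C where "C = (1 / Determinant.det S) \<cdot>\<^sub>m adj_mat S"
  have "(1 / Determinant.det S) \<cdot>\<^sub>m (Determinant.det S \<cdot>\<^sub>m 1\<^sub>m p) = 1\<^sub>m p"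
    using det by (intro eq_matI) auto
  then have "S * C = 1\<^sub>m p" "C * S = 1\<^sub>m p"
    unfolding C_def mult_smult_distrib[OF S adj_mat(1)[OF S]] mult_smult_assoc_mat[OF adj_mat(1)[OF S] S]
      adj_mat(2,3)[OF S] by simp_all
  then show C: "C \<in> carrier_mat p p \<and> S * C = 1\<^sub>m p \<and> C * S = 1\<^sub>m p"
    using adj_mat(1)[OF S] by (simp add: C_def)
  fix D assume D: "D \<in> carrier_mat p p \<and> S * D = 1\<^sub>m p \<and> D * S = 1\<^sub>m p"
  have "D = (C * S) * D" using C D left_mult_one_mat[of D p p] by simp
  also have "\<dots> = C * (S * D)" using C D S by (intro assoc_mult_mat) auto
  also have "\<dots> = C" using C D right_mult_one_mat[of C p p] by simp
  finally show "D = C" .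
qed

lemma hermitian_pd_imp_hpd_inverse:
  assumes "hermitian_pd p S"
  shows "hpd_inverse p (\<lambda>i j. S $$ (i, j)) (\<lambda>i j. inv_mat p S $$ (i, j))"
proof
  have S: "S \<in> carrier_mat p p" using assms by (simp add: hermitian_pd_def)
  note B = inv_mat_inverse[OF S hermitian_pd_det_nonzero[OF assms]]
  have ent: "(X * Y) $$ (i, j) = (\<Sum>k<p. X $$ (i, k) * Y $$ (k, j))"
    if "X \<in> carrier_mat p p" "Y \<in> carrier_mat p p" "i < p" "j < p" for X Y :: "complex mat" and i j
    using that by (simp add: scalar_prod_def atLeast0LessThan)
  show "S $$ (i, j) = cnj (S $$ (j, i))" if "i < p" "j < p" for i j
    using assms that unfolding hermitian_pd_def by blast
  show "0 < Re (sesq p (\<lambda>i j. S $$ (i, j)) v)" if "i < p" "v i \<noteq> 0" for v i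
  proof -
    have "Matrix.vec p v \<noteq> 0\<^sub>v p"
      using that by (metis index_vec index_zero_vec(1))
    then show ?thesis
      using assms vec_carrier[of p v] unfolding hermitian_pd_def sesq_eq_scalar_prod[OF S, symmetric] by blast
  qed
  show "(\<Sum>k<p. S $$ (i, k) * inv_mat p S $$ (k, j)) = of_bool (i = j)" if "i < p" "j < p" for i j
    using ent[OF S _ that, of "inv_mat p S", symmetric] B that by simp
  show "(\<Sum>k<p. inv_mat p S $$ (i, k) * S $$ (k, j)) = of_bool (i = j)" if "i < p" "j < p" for i j
    using ent[OF _ S that, of "inv_mat p S", symmetric] B that by simp
qed

text \<open>The denominator of the density equals the zeroth moment of the unnormalised Gaussian and
  cancels.\<close>

lemma cn_moment_eq_sum_tables:
  assumes "hermitian_pd p S"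
  shows "cn_moment p S n m = (\<Sum>a\<in>tables p n m. Pi_term p S n m a)"
proof -
  have S: "S \<in> carrier_mat p p" using assms by (simp add: hermitian_pd_def)
  note det = hermitian_pd_det_nonzero[OF assms]
  interpret hpd_inverse p "\<lambda>i j. S $$ (i, j)" "\<lambda>i j. inv_mat p S $$ (i, j)"
    by (rule hermitian_pd_imp_hpd_inverse[OF assms])
  define Z where "Z = complex_of_real pi ^ p * Determinant.det S"
  have Z: "Z \<noteq> 0" using det by (simp add: Z_def)
  have "mat p p (\<lambda>(i, j). S $$ (i, j)) = S" using S by auto
  then have norm: "gaussian_moment (\<lambda>_. 0) (\<lambda>_. 0) = Z"
    using integral_exp_sesq[OF hermitian_pd_imp_hpd_inverse[OF assms]]
    by (simp add: gaussian_moment_def cmono_def Z_def)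
  have "cn_moment p S n m = gaussian_moment n m / Z"
    using inv_mat_inverse[OF S det]
    by (simp add: cn_moment_def gaussian_moment_def cn_density_def Let_def sesq_eq_scalar_prod
        cmono_def Z_def)
  also have "\<dots> = (\<Prod>i<p. fact (n i)) * (\<Prod>i<p. fact (m i)) * table_sum p (\<lambda>i j. S $$ (i, j)) n m"
    using Z by (subst gaussian_moment_eq_table_sum) (simp add: norm)
  also have "\<dots> = (\<Sum>a\<in>tables p n m. Pi_term p S n m a)"
    by (simp add: table_sum_def table_weight_def Pi_term_def sum_distrib_left prod.distrib)
  finally show ?thesis .
qed

text \<open>Row \<open>h\<close> has positive sum, hence a positive entry in some column
  \<open>k\<close>. The column bound then forces \<open>m k\<close> to be positive, so a zero
  covariance is raised to a positive power.\<close>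

lemma Pi_term_eq_0:
  assumes a: "a \<in> I_set p n m" and h: "h < p" "n h \<noteq> 0"
    and S: "\<And>k. k < p \<Longrightarrow> m k \<noteq> 0 \<Longrightarrow> S $$ (h, k) = 0"
  shows "Pi_term p S n m a = 0"
proof -
  have "(\<Sum>k<p. a h k) \<noteq> 0"
    using I_set_margins(1)[OF a h(1)] h(2) by simp
  then obtain k where k: "k < p" "a h k \<noteq> 0"
    by (metis lessThan_iff sum.neutral)
  have "a h k \<le> (\<Sum>i<p. a i k)"
    using h(1) by (intro member_le_sum) auto
  then have "m k \<noteq> 0"
    using I_set_margins(2)[OF a k(1)] k(2) by simp
  then have "S $$ (h, k) ^ a h k / of_nat (fact (a h k)) = 0"
    using S[OF k(1)] k(2) by simp
  then have "(\<Prod>h<p. \<Prod>k<p. S $$ (h, k) ^ a h k / of_nat (fact (a h k))) = 0"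
    using h(1) k(1) by (intro prod_zero bexI[of _ h] bexI[of _ k]) auto
  then show ?thesis by (simp add: Pi_term_def)
qed

theorem theorem3p15:
  fixes p :: nat and S :: "complex mat" and n m :: "nat \<Rightarrow> nat"
  assumes "hermitian_pd p S"
    and "\<forall>Mr \<in> induced_partition {k. k < p \<and> m k \<noteq> 0} {h. h < p \<and> n h \<noteq> 0}
                (\<lambda>h. {k. k < p \<and> m k \<noteq> 0 \<and> S $$ (h,k) \<noteq> 0}).
           (\<Sum>i \<in> {i. i < p \<and> n i \<noteq> 0 \<and> {k. k < p \<and> m k \<noteq> 0 \<and> S $$ (i,k) \<noteq> 0} \<subseteq> Mr}. n i)
           = (\<Sum>j\<in>Mr. m j)"
  shows "cn_moment p S n m = (\<Sum>a \<in> I_set p n m. Pi_term p S n m a)"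
proof (cases "(\<Sum>i<p. n i) = (\<Sum>j<p. m j)")
  case True
  then show ?thesis
    by (simp add: cn_moment_eq_sum_tables[OF assms(1)] I_set_eq_tables)
next
  case False
  define T where "T h = {k. k < p \<and> m k \<noteq> 0 \<and> S $$ (h, k) \<noteq> 0}" for h
  have "\<exists>h<p. n h \<noteq> 0 \<and> T h = {}"
  proof (rule ccontr)
    \<comment> \<open>If every \<open>T h\<close> were nonempty, the balance equations would add up
      to equal totals, against the case assumption.\<close>
    assume none: "\<not> ?thesis"
    have "(\<Sum>i\<in>{h. h < p \<and> n h \<noteq> 0}. n i) = (\<Sum>j\<in>{k. k < p \<and> m k \<noteq> 0}. m j)"
    proof (rule induced_partition_sum[where T = T])
      show "T h \<noteq> {}" if "h \<in> {h. h < p \<and> n h \<noteq> 0}" for h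
        using none that by blast
      show "T h \<subseteq> {k. k < p \<and> m k \<noteq> 0}" for h
        unfolding T_def by blast
      show "(\<Sum>i\<in>{i \<in> {h. h < p \<and> n h \<noteq> 0}. T i \<subseteq> C}. n i) = (\<Sum>j\<in>C. m j)"
        if "C \<in> induced_partition {k. k < p \<and> m k \<noteq> 0} {h. h < p \<and> n h \<noteq> 0} T" for C
        using assms(2)[folded T_def] that by (simp add: conj_assoc)
    qed simp_all
    moreover have "(\<Sum>i\<in>{i. i < p \<and> f i \<noteq> 0}. f i) = (\<Sum>i<p. f i)" for f :: "nat \<Rightarrow> nat"
      by (intro sum.mono_neutral_left) auto
    ultimately show False using False by simp
  qed
  then obtain h where h: "h < p" "n h \<noteq> 0" "T h = {}" by blast
  then have "Pi_term p S n m a = 0" if "a \<in> I_set p n m" for a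
    using that by (intro Pi_term_eq_0[where h = h]) (auto simp: T_def)
  then show ?thesis
    by (simp add: cn_moment_eq_sum_tables[OF assms(1)] tables_eq_empty[OF False])
qed

end
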